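(* Let $p$ be a prime and let $a,b,d$ be integers with $0\le b\le a$, $a\equiv b\pmod{p-1}$ and $d\ge1$. Then $$S(p^\infty a+d-1,p^\infty b+d)= T_p(d-1,d)\binom{p^\infty\frac{pa-b}{p-1}-1}{p^\infty b}.$$
   Context: $\mathbb{Z}_p$ denotes the $p$-adic integers. $S(n,k)$ denotes the Stirling numbers of the second kind. Define $S(p^\infty a+c,p^\infty b+d):=\lim_{e\to\infty}S(p^e a+c,p^e b+d)$, the limit being taken in $\mathbb{Z}_p$ (these limits exist). For integers $0\le\beta\le\alpha$, define $\binom{p^\infty\alpha-1}{p^\infty\beta}:=\lim_{e\to\infty}\binom{p^e\alpha-1}{p^e\beta}$ in $\mathbb{Z}_p$. For a prime $p$, an integer $n$ and a nonnegative integer $k$, the partial Stirling number is the rational number $$T_p(n,k)=\frac{(-1)^{k}}{k!}\sum_{\substack{0\le i\le k\\ i\not\equiv0\ (\mathrm{mod}\ p)}}(-1)^i\binom ki i^n.$$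
   Formalization: For a = b = 0 the binomial coefficient with upper entry -1 and lower entry 0 is taken to be 0 instead of the usual 1; with the value 1 the identity fails at a = b = 0, d = 1, where S(0,1) = 0 but T_p(0,1) = 1. *)

theory Defs
  imports
    "HOL-Analysis.Abstract_Metric_Spaces"
    "HOL-Algebra.QuotRing"
    "HOL-Number_Theory.Cong"
    "HOL-Combinatorics.Stirling"
begin

section \<open>The p-adic absolute value on the rationals\<close>

definition padic_val :: "nat \<Rightarrow> rat \<Rightarrow> int" where
  "padic_val p r =
     int (multiplicity (int p) (fst (quotient_of r))) - int (multiplicity (int p) (snd (quotient_of r)))"

definition padic_abs :: "nat \<Rightarrow> rat \<Rightarrow> real" where
  "padic_abs p r = (if r = 0 then 0 else real p powi (- padic_val p r))"

lemma padic_val_divide: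
  assumes "prime p" "a \<noteq> 0" "b \<noteq> 0"
  shows "padic_val p (of_int a / of_int b) = int (multiplicity (int p) a) - int (multiplicity (int p) b)"
proof -
  obtain x y where xy: "quotient_of (of_int a / of_int b) = (x, y)" by force
  have y: "y > 0" using xy quotient_of_denom_pos by blast
  have eq: "(of_int a / of_int b :: rat) = of_int x / of_int y" using xy quotient_of_div by blast
  then have "(of_int (a * y) :: rat) = of_int (x * b)"
    using assms y by (simp add: field_simps)
  then have e: "a * y = x * b" using of_int_eq_iff by blast
  then have "x \<noteq> 0" using assms y by auto
  moreover have "prime_elem (int p)" using assms by auto
  ultimately have "multiplicity (int p) a + multiplicity (int p) y = multiplicity (int p) x + multiplicity (int p) b"
    using assms y e by (metis less_irrefl prime_elem_multiplicity_mult_distrib)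
  then show ?thesis by (simp add: padic_val_def xy)
qed

lemma rat_cases_int: obtains a b :: int where "(r::rat) = of_int a / of_int b" "b \<noteq> 0"
  by (metis quotient_of_denom_pos quotient_of_div surj_pair less_irrefl)

lemma padic_abs_0 [simp]: "padic_abs p 0 = 0"
  by (simp add: padic_abs_def)

lemma padic_abs_nonneg [simp]: "0 \<le> padic_abs p r"
  by (simp add: padic_abs_def zero_le_power_int)

lemma padic_abs_eq_0_iff: "prime p \<Longrightarrow> padic_abs p r = 0 \<longleftrightarrow> r = 0"
  by (simp add: padic_abs_def prime_gt_0_nat)

lemma padic_val_mult:
  assumes "prime p" "r \<noteq> 0" "s \<noteq> 0"
  shows "padic_val p (r * s) = padic_val p r + padic_val p s"
proof -
  obtain a b where r: "r = of_int a / of_int b" "b \<noteq> 0" by (rule rat_cases_int)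
  obtain c d where s: "s = of_int c / of_int d" "d \<noteq> 0" by (rule rat_cases_int)
  have nz: "a \<noteq> 0" "c \<noteq> 0" using assms r s by auto
  have "r * s = of_int (a * c) / of_int (b * d)" using r s by simp
  then show ?thesis
    using assms r s nz
    by (simp only: padic_val_divide mult_eq_0_iff simp_thms)
       (simp add: prime_elem_multiplicity_mult_distrib)
qed

lemma padic_abs_mult:
  assumes "prime p"
  shows "padic_abs p (r * s) = padic_abs p r * padic_abs p s"
  using assms prime_gt_0_nat[OF assms]
  by (auto simp: padic_abs_def padic_val_mult power_int_diff power_int_minus field_simps power_int_add)

lemma padic_abs_1 [simp]: "prime p \<Longrightarrow> padic_abs p 1 = 1"
  by (simp add: padic_abs_def padic_val_def)

lemma padic_abs_of_int_le_1: "prime p \<Longrightarrow> padic_abs p (of_int n) \<le> 1"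
  using prime_gt_0_nat[of p]
  by (auto simp: padic_abs_def padic_val_def power_int_minus power_int_def inverse_le_1_iff intro!: power_le_one)

lemma padic_abs_minus [simp]: "padic_abs p (- r) = padic_abs p r"
proof -
  have "multiplicity (int p) (- x) = multiplicity (int p) x" for x
    by (rule multiplicity_cong) simp
  then show ?thesis by (simp add: padic_abs_def padic_val_def rat_uminus_code split: prod.split)
qed

lemma padic_abs_minus_commute: "padic_abs p (r - s) = padic_abs p (s - r)"
  by (metis minus_diff_eq padic_abs_minus)

lemma padic_abs_add:
  assumes p: "prime p"
  shows "padic_abs p (r + s) \<le> max (padic_abs p r) (padic_abs p s)"
proof -
  have main: "padic_abs p (1 + t) \<le> 1" if t: "padic_abs p t \<le> 1" "t \<noteq> 0" for t
  proof (cases "1 + t = 0")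
    case False
    obtain x y where xy: "quotient_of t = (x, y)" by force
    have y: "y > 0" using xy quotient_of_denom_pos by blast
    have eq: "t = of_int x / of_int y" using xy quotient_of_div by blast
    have cop: "coprime x y" using xy quotient_of_coprime by blast
    have x0: "x \<noteq> 0" using eq t by auto
    have p1: "real p > 1" using p prime_gt_1_nat by auto
    have "padic_val p t \<ge> 0"
    proof (rule ccontr)
      assume "\<not> padic_val p t \<ge> 0"
      then have "real p powi 0 < real p powi (- padic_val p t)"
        using p1 by (intro power_int_strict_increasing) auto
      then show False using t by (simp add: padic_abs_def)
    qed
    then have "multiplicity (int p) y \<le> multiplicity (int p) x"
      by (simp add: padic_val_def xy)
    then have ny: "\<not> int p dvd y"
      using cop p y x0 not_coprimeI[of "int p" x y]
      by (metis not_dvd_imp_multiplicity_0 le_0_eq less_irrefl multiplicity_eq_zero_iff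
            not_prime_unit prime_int_nat_transfer nat_int of_nat_0_le_iff prime_nat_int_transfer)
    have e: "1 + t = of_int (x + y) / of_int y" using eq y by (simp add: field_simps)
    then have "x + y \<noteq> 0" using False by auto
    then have "padic_val p (1 + t) \<ge> 0"
      unfolding e using padic_val_divide[OF p, of "x + y" y] y ny
      by (simp add: not_dvd_imp_multiplicity_0)
    then have "real p powi (- padic_val p (1 + t)) \<le> real p powi 0"
      using p1 by (intro power_int_increasing) auto
    then show ?thesis by (simp add: padic_abs_def)
  qed auto
  have key: "padic_abs p (r + s) \<le> padic_abs p r"
    if "padic_abs p s \<le> padic_abs p r" "r \<noteq> 0" "s \<noteq> 0" for r s
  proof -
    have rs: "padic_abs p s = padic_abs p r * padic_abs p (s / r)"
      using that padic_abs_mult[OF p, of r "s / r"] by simp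
    have pos: "padic_abs p r > 0"
      using that padic_abs_eq_0_iff[OF p, of r] padic_abs_nonneg[of p r] by linarith
    then have "padic_abs p (s / r) \<le> 1" using that rs by (simp add: mult_le_cancel_left1)
    then have "padic_abs p (1 + s / r) \<le> 1" using main that by simp
    moreover have "r + s = r * (1 + s / r)" using that by (simp add: field_simps)
    ultimately show ?thesis using padic_abs_mult[OF p, of r "1 + s / r"] pos
      by (simp add: mult_left_le)
  qed
  show ?thesis
  proof (cases "r = 0 \<or> s = 0")
    case False
    then show ?thesis using key[of s r] key[of r s] add.commute[of s r]
      by (cases "padic_abs p s \<le> padic_abs p r") auto
  qed (auto simp: max_def)
qed

lemma padic_abs_triangle: "prime p \<Longrightarrow> padic_abs p (r + s) \<le> padic_abs p r + padic_abs p s"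
  using padic_abs_add[of p r s] padic_abs_nonneg[of p r] padic_abs_nonneg[of p s] by linarith

lemma padic_abs_diff: "prime p \<Longrightarrow> \<bar>padic_abs p r - padic_abs p s\<bar> \<le> padic_abs p (r - s)"
  using padic_abs_triangle[of p "r - s" s] padic_abs_triangle[of p "s - r" r]
    padic_abs_minus_commute[of p r s] by simp


section \<open>The field of p-adic numbers and the ring of p-adic integers\<close>

definition padic_Cauchy :: "nat \<Rightarrow> (nat \<Rightarrow> rat) set" where
  "padic_Cauchy p = {x. \<forall>\<epsilon>>0. \<exists>N. \<forall>m\<ge>N. \<forall>n\<ge>N. padic_abs p (x m - x n) < \<epsilon>}"

definition padic_null :: "nat \<Rightarrow> (nat \<Rightarrow> rat) set" where
  "padic_null p = {x. (\<lambda>n. padic_abs p (x n)) \<longlonglongrightarrow> 0}"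

definition padic_Cauchy_ring :: "nat \<Rightarrow> (nat \<Rightarrow> rat) ring" where
  "padic_Cauchy_ring p =
     \<lparr>carrier = padic_Cauchy p, monoid.mult = (\<lambda>x y n. x n * y n), one = (\<lambda>_. 1),
      zero = (\<lambda>_. 0), add = (\<lambda>x y n. x n + y n)\<rparr>"

text \<open>The completion of the rationals with respect to the p-adic absolute value.\<close>

definition Qp :: "nat \<Rightarrow> (nat \<Rightarrow> rat) set ring" where
  "Qp p = padic_Cauchy_ring p Quot padic_null p"

definition padic_of_rat :: "nat \<Rightarrow> rat \<Rightarrow> (nat \<Rightarrow> rat) set" where
  "padic_of_rat p r = padic_null p +>\<^bsub>padic_Cauchy_ring p\<^esub> (\<lambda>_. r)"

definition padic_norm :: "nat \<Rightarrow> (nat \<Rightarrow> rat) set \<Rightarrow> real" where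
  "padic_norm p X = (THE r. \<forall>x\<in>X. (\<lambda>n. padic_abs p (x n)) \<longlonglongrightarrow> r)"

text \<open>The value off the carrier is irrelevant, but \<open>Metric_space\<close> asks for symmetry and
  nonnegativity there as well.\<close>

definition padic_dist :: "nat \<Rightarrow> (nat \<Rightarrow> rat) set \<Rightarrow> (nat \<Rightarrow> rat) set \<Rightarrow> real" where
  "padic_dist p X Y =
     (if X \<in> carrier (Qp p) \<and> Y \<in> carrier (Qp p) then padic_norm p (X \<ominus>\<^bsub>Qp p\<^esub> Y) else 0)"

definition Zp :: "nat \<Rightarrow> (nat \<Rightarrow> rat) set set" where
  "Zp p = {X \<in> carrier (Qp p). padic_norm p X \<le> 1}"

definition Zp_topology :: "nat \<Rightarrow> (nat \<Rightarrow> rat) set topology" where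
  "Zp_topology p = Metric_space.mtopology (Zp p) (padic_dist p)"

definition padic_convergent :: "nat \<Rightarrow> (nat \<Rightarrow> int) \<Rightarrow> bool" where
  "padic_convergent p f \<longleftrightarrow>
     (\<exists>L. limitin (Zp_topology p) (\<lambda>e. padic_of_rat p (of_int (f e))) L sequentially)"

definition padic_lim :: "nat \<Rightarrow> (nat \<Rightarrow> int) \<Rightarrow> (nat \<Rightarrow> rat) set" where
  "padic_lim p f =
     (THE L. limitin (Zp_topology p) (\<lambda>e. padic_of_rat p (of_int (f e))) L sequentially)"


subsection \<open>Well-definedness\<close>

lemma padic_Cauchy_conv:
  assumes p: "prime p" and x: "x \<in> padic_Cauchy p"
  shows "convergent (\<lambda>n. padic_abs p (x n))"
proof -
  have "Cauchy (\<lambda>n. padic_abs p (x n))"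
    unfolding Cauchy_def dist_real_def
    using x padic_abs_diff[OF p] unfolding padic_Cauchy_def
    by (smt (verit, best) mem_Collect_eq)
  then show ?thesis by (simp add: Cauchy_convergent_iff)
qed

lemma padic_Cauchy_bounded:
  assumes p: "prime p" and x: "x \<in> padic_Cauchy p"
  obtains B where "B > 0" "\<And>n. padic_abs p (x n) \<le> B"
proof -
  have "Bseq (\<lambda>n. padic_abs p (x n))"
    using padic_Cauchy_conv[OF p x] by (rule convergent_imp_Bseq)
  then show ?thesis using that by (auto simp: Bseq_def)
qed

lemma padic_Cauchy_const [simp]: "(\<lambda>_. r) \<in> padic_Cauchy p"
  by (simp add: padic_Cauchy_def)

lemma padic_Cauchy_add:
  assumes p: "prime p" and x: "x \<in> padic_Cauchy p" and y: "y \<in> padic_Cauchy p"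
  shows "(\<lambda>n. x n + y n) \<in> padic_Cauchy p"
  unfolding padic_Cauchy_def
proof (intro CollectI allI impI)
  fix \<epsilon> :: real assume e: "\<epsilon> > 0"
  obtain N where N: "\<And>m n. m \<ge> N \<Longrightarrow> n \<ge> N \<Longrightarrow> padic_abs p (x m - x n) < \<epsilon>"
    using x e unfolding padic_Cauchy_def by blast
  obtain M where M: "\<And>m n. m \<ge> M \<Longrightarrow> n \<ge> M \<Longrightarrow> padic_abs p (y m - y n) < \<epsilon>"
    using y e unfolding padic_Cauchy_def by blast
  have "padic_abs p (x m + y m - (x n + y n)) < \<epsilon>" if "m \<ge> max N M" "n \<ge> max N M" for m n
  proof -
    have "padic_abs p ((x m - x n) + (y m - y n)) < \<epsilon>"
      using padic_abs_add[OF p, of "x m - x n" "y m - y n"] N[of m n] M[of m n] that by auto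
    then show ?thesis by (simp add: algebra_simps)
  qed
  then show "\<exists>N. \<forall>m\<ge>N. \<forall>n\<ge>N. padic_abs p (x m + y m - (x n + y n)) < \<epsilon>" by blast
qed

lemma padic_Cauchy_mult:
  assumes p: "prime p" and x: "x \<in> padic_Cauchy p" and y: "y \<in> padic_Cauchy p"
  shows "(\<lambda>n. x n * y n) \<in> padic_Cauchy p"
  unfolding padic_Cauchy_def
proof (intro CollectI allI impI)
  fix \<epsilon> :: real assume e: "\<epsilon> > 0"
  obtain A where A: "A > 0" "\<And>n. padic_abs p (x n) \<le> A" using padic_Cauchy_bounded[OF p x] by blast
  obtain B where B: "B > 0" "\<And>n. padic_abs p (y n) \<le> B" using padic_Cauchy_bounded[OF p y] by blast
  obtain N where N: "\<And>m n. m \<ge> N \<Longrightarrow> n \<ge> N \<Longrightarrow> padic_abs p (x m - x n) < \<epsilon> / B"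
    using x divide_pos_pos[OF e B(1)] unfolding padic_Cauchy_def by blast
  obtain M where M: "\<And>m n. m \<ge> M \<Longrightarrow> n \<ge> M \<Longrightarrow> padic_abs p (y m - y n) < \<epsilon> / A"
    using y divide_pos_pos[OF e A(1)] unfolding padic_Cauchy_def by blast
  have "padic_abs p (x m * y m - x n * y n) < \<epsilon>" if mn: "m \<ge> max N M" "n \<ge> max N M" for m n
  proof -
    have 1: "padic_abs p (x m * (y m - y n)) < \<epsilon>"
    proof -
      have "padic_abs p (x m * (y m - y n)) \<le> A * padic_abs p (y m - y n)"
        by (simp add: padic_abs_mult[OF p] A mult_right_mono)
      also have "\<dots> < A * (\<epsilon> / A)" using M[of m n] mn A by (intro mult_strict_left_mono) auto
      finally show ?thesis using A by simp
    qed
    have 2: "padic_abs p (y n * (x m - x n)) < \<epsilon>"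
    proof -
      have "padic_abs p (y n * (x m - x n)) \<le> B * padic_abs p (x m - x n)"
        by (simp add: padic_abs_mult[OF p] B mult_right_mono)
      also have "\<dots> < B * (\<epsilon> / B)" using N[of m n] mn B by (intro mult_strict_left_mono) auto
      finally show ?thesis using B by simp
    qed
    have "x m * y m - x n * y n = x m * (y m - y n) + y n * (x m - x n)"
      by (simp add: algebra_simps)
    then show ?thesis
      using padic_abs_add[OF p, of "x m * (y m - y n)" "y n * (x m - x n)"] 1 2 by auto
  qed
  then show "\<exists>N. \<forall>m\<ge>N. \<forall>n\<ge>N. padic_abs p (x m * y m - x n * y n) < \<epsilon>" by blast
qed

lemma padic_Cauchy_minus: "x \<in> padic_Cauchy p \<Longrightarrow> (\<lambda>n. - x n) \<in> padic_Cauchy p"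
  using padic_abs_minus_commute by (simp add: padic_Cauchy_def)

lemma padic_null_iff: "x \<in> padic_null p \<longleftrightarrow> (\<lambda>n. padic_abs p (x n)) \<longlonglongrightarrow> 0"
  by (simp add: padic_null_def)

lemma padic_null_subset:
  assumes p: "prime p" shows "padic_null p \<subseteq> padic_Cauchy p"
proof
  fix x assume "x \<in> padic_null p"
  then have lim: "(\<lambda>n. padic_abs p (x n)) \<longlonglongrightarrow> 0" by (simp add: padic_null_iff)
  show "x \<in> padic_Cauchy p"
    unfolding padic_Cauchy_def
  proof (intro CollectI allI impI)
    fix \<epsilon> :: real assume "\<epsilon> > 0"
    then obtain N where N: "\<And>n. n \<ge> N \<Longrightarrow> padic_abs p (x n) < \<epsilon>"
      using order_tendstoD(2)[OF lim] by (auto simp: eventually_sequentially)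
    have "padic_abs p (x m - x n) < \<epsilon>" if "m \<ge> N" "n \<ge> N" for m n
      using padic_abs_add[OF p, of "x m" "- x n"] N[of m] N[of n] that by auto
    then show "\<exists>N. \<forall>m\<ge>N. \<forall>n\<ge>N. padic_abs p (x m - x n) < \<epsilon>" by blast
  qed
qed

lemma padic_null_add:
  assumes p: "prime p" and "x \<in> padic_null p" "y \<in> padic_null p"
  shows "(\<lambda>n. x n + y n) \<in> padic_null p"
proof -
  have "(\<lambda>n. padic_abs p (x n) + padic_abs p (y n)) \<longlonglongrightarrow> 0"
    using assms tendsto_add[of "\<lambda>n. padic_abs p (x n)" 0 _ "\<lambda>n. padic_abs p (y n)" 0]
    by (simp add: padic_null_iff)
  then have "(\<lambda>n. padic_abs p (x n + y n)) \<longlonglongrightarrow> 0"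
    by (rule Lim_null_comparison[OF always_eventually, rotated]) (simp add: padic_abs_triangle[OF p])
  then show ?thesis by (simp add: padic_null_iff)
qed

lemma padic_null_mult:
  assumes p: "prime p" and x: "x \<in> padic_null p" and y: "y \<in> padic_Cauchy p"
  shows "(\<lambda>n. x n * y n) \<in> padic_null p"
proof -
  obtain B where B: "B > 0" "\<And>n. padic_abs p (y n) \<le> B" using padic_Cauchy_bounded[OF p y] by blast
  have "(\<lambda>n. padic_abs p (x n) * B) \<longlonglongrightarrow> 0"
    using x by (auto simp: padic_null_iff intro: tendsto_mult_left_zero)
  then have "(\<lambda>n. padic_abs p (x n * y n)) \<longlonglongrightarrow> 0"
    by (rule Lim_null_comparison[OF always_eventually, rotated])
       (simp add: padic_abs_mult[OF p] B abs_mult mult_left_mono)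
  then show ?thesis by (simp add: padic_null_iff)
qed

lemma padic_Cauchy_cring:
  assumes p: "prime p" shows "cring (padic_Cauchy_ring p)"
proof (rule cringI)
  show "abelian_group (padic_Cauchy_ring p)"
  proof (rule abelian_groupI)
    fix x assume "x \<in> carrier (padic_Cauchy_ring p)"
    then show "\<exists>y\<in>carrier (padic_Cauchy_ring p). y \<oplus>\<^bsub>padic_Cauchy_ring p\<^esub> x = \<zero>\<^bsub>padic_Cauchy_ring p\<^esub>"
      by (intro bexI[of _ "\<lambda>n. - x n"]) (auto simp: padic_Cauchy_ring_def padic_Cauchy_minus)
  qed (auto simp: padic_Cauchy_ring_def padic_Cauchy_add[OF p] algebra_simps)
  show "comm_monoid (padic_Cauchy_ring p)"
    by (rule comm_monoidI) (auto simp: padic_Cauchy_ring_def padic_Cauchy_mult[OF p] algebra_simps)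
qed (auto simp: padic_Cauchy_ring_def algebra_simps)

lemma padic_Cauchy_ring_a_inv:
  assumes p: "prime p" and x: "x \<in> padic_Cauchy p"
  shows "\<ominus>\<^bsub>padic_Cauchy_ring p\<^esub> x = (\<lambda>n. - x n)"
proof -
  interpret cring "padic_Cauchy_ring p" using p by (rule padic_Cauchy_cring)
  show ?thesis
    by (rule minus_equality) (use x in \<open>auto simp: padic_Cauchy_ring_def padic_Cauchy_minus\<close>)
qed

lemma padic_null_ideal:
  assumes p: "prime p" shows "ideal (padic_null p) (padic_Cauchy_ring p)"
proof -
  interpret cring "padic_Cauchy_ring p" using p by (rule padic_Cauchy_cring)
  have "subgroup (padic_null p) (add_monoid (padic_Cauchy_ring p))"
  proof (rule add.subgroupI)
    show "padic_null p \<subseteq> carrier (padic_Cauchy_ring p)"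
      using padic_null_subset[OF p] by (simp add: padic_Cauchy_ring_def)
    show "padic_null p \<noteq> {}"
      using padic_null_iff[of "\<lambda>_. 0" p] by force
    show "\<ominus>\<^bsub>padic_Cauchy_ring p\<^esub> x \<in> padic_null p" if "x \<in> padic_null p" for x
      using that padic_null_subset[OF p] padic_Cauchy_ring_a_inv[OF p, of x]
      by (auto simp: padic_null_iff)
    show "x \<oplus>\<^bsub>padic_Cauchy_ring p\<^esub> y \<in> padic_null p" if "x \<in> padic_null p" "y \<in> padic_null p" for x y
      using that padic_null_add[OF p, of x y] by (simp add: padic_Cauchy_ring_def)
  qed
  then show ?thesis
    using padic_null_mult[OF p] ring_axioms
    by (intro idealI) (auto simp: padic_Cauchy_ring_def mult.commute)
qed

lemma Qp_cring: "prime p \<Longrightarrow> cring (Qp p)"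
  unfolding Qp_def by (intro ideal.quotient_is_cring padic_null_ideal padic_Cauchy_cring)

abbreviation padic_class :: "nat \<Rightarrow> (nat \<Rightarrow> rat) \<Rightarrow> (nat \<Rightarrow> rat) set" where
  "padic_class p x \<equiv> padic_null p +>\<^bsub>padic_Cauchy_ring p\<^esub> x"

lemma padic_class_ring_hom:
  "prime p \<Longrightarrow> ring_hom_cring (padic_Cauchy_ring p) (Qp p) (padic_class p)"
  unfolding Qp_def
  by (intro ideal.rcos_ring_hom_cring padic_null_ideal padic_Cauchy_cring)

lemma carrier_Qp: "carrier (Qp p) = padic_class p ` padic_Cauchy p"
  by (auto simp: Qp_def FactRing_def A_RCOSETS_def' padic_Cauchy_ring_def)

lemma mem_padic_class: "y \<in> padic_class p x \<longleftrightarrow> (\<lambda>n. y n - x n) \<in> padic_null p"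
proof -
  have "y \<in> padic_class p x \<longleftrightarrow> (\<exists>h\<in>padic_null p. y = (\<lambda>n. h n + x n))"
    by (auto simp: a_r_coset_def' padic_Cauchy_ring_def)
  also have "\<dots> \<longleftrightarrow> (\<lambda>n. y n - x n) \<in> padic_null p"
    by (auto intro!: bexI[of _ "\<lambda>n. y n - x n"])
  finally show ?thesis .
qed

lemma self_mem_padic_class: "x \<in> padic_class p x"
  by (simp add: mem_padic_class padic_null_iff)

lemma padic_class_eq_iff:
  assumes p: "prime p" and "x \<in> padic_Cauchy p" "y \<in> padic_Cauchy p"
  shows "padic_class p x = padic_class p y \<longleftrightarrow> (\<lambda>n. x n - y n) \<in> padic_null p"
proof
  assume "padic_class p x = padic_class p y"
  then show "(\<lambda>n. x n - y n) \<in> padic_null p" using self_mem_padic_class mem_padic_class by blast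
next
  assume a: "(\<lambda>n. x n - y n) \<in> padic_null p"
  then have a': "(\<lambda>n. y n - x n) \<in> padic_null p"
    by (simp add: padic_null_iff padic_abs_minus_commute)
  have "(\<lambda>n. z n - y n) \<in> padic_null p" if "(\<lambda>n. z n - x n) \<in> padic_null p" for z
    using padic_null_add[OF p that a] by simp
  moreover have "(\<lambda>n. z n - x n) \<in> padic_null p" if "(\<lambda>n. z n - y n) \<in> padic_null p" for z
    using padic_null_add[OF p that a'] by simp
  ultimately show "padic_class p x = padic_class p y" by (auto simp: mem_padic_class)
qed

lemma padic_norm_class:
  assumes p: "prime p" and x: "x \<in> padic_Cauchy p"
  shows "(\<lambda>n. padic_abs p (x n)) \<longlonglongrightarrow> padic_norm p (padic_class p x)"
proof -
  obtain r where r: "(\<lambda>n. padic_abs p (x n)) \<longlonglongrightarrow> r"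
    using padic_Cauchy_conv[OF p x] by (auto simp: convergent_def)
  have all: "(\<lambda>n. padic_abs p (y n)) \<longlonglongrightarrow> r" if "y \<in> padic_class p x" for y
  proof -
    have "(\<lambda>n. padic_abs p (y n - x n)) \<longlonglongrightarrow> 0"
      using that by (simp add: mem_padic_class padic_null_iff)
    then have "(\<lambda>n. padic_abs p (y n) - padic_abs p (x n)) \<longlonglongrightarrow> 0"
      by (rule Lim_null_comparison[OF always_eventually, rotated]) (simp add: padic_abs_diff[OF p])
    from tendsto_add[OF this r] show ?thesis by simp
  qed
  have "padic_norm p (padic_class p x) = r"
    unfolding padic_norm_def
    using all self_mem_padic_class LIMSEQ_unique by (intro the_equality) blast+
  then show ?thesis using r by simp
qed

lemma padic_class_diff:
  assumes p: "prime p" and x: "x \<in> padic_Cauchy p" and y: "y \<in> padic_Cauchy p"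
  shows "padic_class p x \<ominus>\<^bsub>Qp p\<^esub> padic_class p y = padic_class p (\<lambda>n. x n - y n)"
proof -
  interpret ring_hom_cring "padic_Cauchy_ring p" "Qp p" "padic_class p"
    using p by (rule padic_class_ring_hom)
  have c: "carrier (padic_Cauchy_ring p) = padic_Cauchy p" by (simp add: padic_Cauchy_ring_def)
  have "padic_class p x \<ominus>\<^bsub>Qp p\<^esub> padic_class p y
          = padic_class p (x \<oplus>\<^bsub>padic_Cauchy_ring p\<^esub> (\<ominus>\<^bsub>padic_Cauchy_ring p\<^esub> y))"
    using x y unfolding c[symmetric] by (simp add: a_minus_def)
  also have "x \<oplus>\<^bsub>padic_Cauchy_ring p\<^esub> (\<ominus>\<^bsub>padic_Cauchy_ring p\<^esub> y) = (\<lambda>n. x n - y n)"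
    unfolding padic_Cauchy_ring_a_inv[OF p y] by (simp add: padic_Cauchy_ring_def)
  finally show ?thesis .
qed

lemma padic_Cauchy_diff:
  "prime p \<Longrightarrow> x \<in> padic_Cauchy p \<Longrightarrow> y \<in> padic_Cauchy p \<Longrightarrow> (\<lambda>n. x n - y n) \<in> padic_Cauchy p"
  using padic_Cauchy_add[of p x "\<lambda>n. - y n"] padic_Cauchy_minus[of y p] by simp

lemma padic_dist_class:
  assumes p: "prime p" and x: "x \<in> padic_Cauchy p" and y: "y \<in> padic_Cauchy p"
  shows "(\<lambda>n. padic_abs p (x n - y n)) \<longlonglongrightarrow> padic_dist p (padic_class p x) (padic_class p y)"
  using padic_norm_class[OF p padic_Cauchy_diff[OF p x y]] x y
  by (simp add: padic_dist_def padic_class_diff[OF p x y] carrier_Qp)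

lemma Metric_space_Qp:
  assumes p: "prime p"
  shows "Metric_space (carrier (Qp p)) (padic_dist p)"
proof
  fix X Y
  show "0 \<le> padic_dist p X Y"
  proof (cases "X \<in> carrier (Qp p) \<and> Y \<in> carrier (Qp p)")
    case True
    then obtain x y where xy: "x \<in> padic_Cauchy p" "y \<in> padic_Cauchy p"
      "X = padic_class p x" "Y = padic_class p y" by (auto simp: carrier_Qp)
    show ?thesis using padic_dist_class[OF p xy(1,2)] xy
      by (auto intro: LIMSEQ_le_const)
  qed (auto simp: padic_dist_def)
  show "padic_dist p X Y = padic_dist p Y X"
  proof (cases "X \<in> carrier (Qp p) \<and> Y \<in> carrier (Qp p)")
    case True
    then obtain x y where xy: "x \<in> padic_Cauchy p" "y \<in> padic_Cauchy p"
      "X = padic_class p x" "Y = padic_class p y" by (auto simp: carrier_Qp)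
    show ?thesis
      using padic_dist_class[OF p xy(1,2)] padic_dist_class[OF p xy(2,1)] xy LIMSEQ_unique
      by (auto simp: padic_abs_minus_commute[of p "y _"])
  qed (auto simp: padic_dist_def)
next
  fix X Y assume "X \<in> carrier (Qp p)" "Y \<in> carrier (Qp p)"
  then obtain x y where xy: "x \<in> padic_Cauchy p" "y \<in> padic_Cauchy p"
    "X = padic_class p x" "Y = padic_class p y" by (auto simp: carrier_Qp)
  have lim: "(\<lambda>n. padic_abs p (x n - y n)) \<longlonglongrightarrow> padic_dist p X Y"
    using padic_dist_class[OF p xy(1,2)] xy by simp
  show "padic_dist p X Y = 0 \<longleftrightarrow> X = Y"
    using lim LIMSEQ_unique[OF lim, of 0] padic_class_eq_iff[OF p xy(1,2)] xy
    by (auto simp: padic_null_iff)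
next
  fix X Y Z assume "X \<in> carrier (Qp p)" "Y \<in> carrier (Qp p)" "Z \<in> carrier (Qp p)"
  then obtain x y z where xyz: "x \<in> padic_Cauchy p" "y \<in> padic_Cauchy p" "z \<in> padic_Cauchy p"
    "X = padic_class p x" "Y = padic_class p y" "Z = padic_class p z" by (auto simp: carrier_Qp)
  show "padic_dist p X Z \<le> padic_dist p X Y + padic_dist p Y Z"
    unfolding xyz(4-6)
  proof (rule LIMSEQ_le[OF padic_dist_class tendsto_add[OF padic_dist_class padic_dist_class]])
    show "\<exists>N. \<forall>n\<ge>N. padic_abs p (x n - z n) \<le> padic_abs p (x n - y n) + padic_abs p (y n - z n)"
    proof (intro exI allI impI)
      fix n show "padic_abs p (x n - z n) \<le> padic_abs p (x n - y n) + padic_abs p (y n - z n)"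
        using padic_abs_triangle[OF p, of "x n - y n" "y n - z n"] by simp
    qed
  qed (use p xyz in auto)
qed

lemma Metric_space_Zp: "prime p \<Longrightarrow> Metric_space (Zp p) (padic_dist p)"
  by (rule Metric_space.subspace[OF Metric_space_Qp]) (auto simp: Zp_def)

lemma padic_lim_eqI:
  assumes "prime p" "limitin (Zp_topology p) (\<lambda>e. padic_of_rat p (of_int (f e))) L sequentially"
  shows "padic_lim p f = L"
  unfolding padic_lim_def
proof (rule the_equality)
  fix L' assume "limitin (Zp_topology p) (\<lambda>e. padic_of_rat p (of_int (f e))) L' sequentially"
  then show "L' = L"
    using assms(2) Metric_space.limitin_metric_unique[OF Metric_space_Zp[OF assms(1)]]
    unfolding Zp_topology_def by (metis sequentially_bot)
qed (fact assms(2))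

lemma padic_of_int_Zp:
  assumes p: "prime p" shows "padic_of_rat p (of_int n) \<in> Zp p"
proof -
  have "padic_norm p (padic_of_rat p (of_int n)) = padic_abs p (of_int n)"
    using padic_norm_class[OF p, of "\<lambda>_. of_int n"]
    by (simp add: padic_of_rat_def LIMSEQ_const_iff)
  then show ?thesis
    using padic_abs_of_int_le_1[OF p, of n] by (simp add: Zp_def carrier_Qp padic_of_rat_def)
qed

lemma Qp_field:
  assumes p: "prime p" shows "field (Qp p)"
proof -
  interpret ring_hom_cring "padic_Cauchy_ring p" "Qp p" "padic_class p"
    using p by (rule padic_class_ring_hom)
  have one: "\<one>\<^bsub>Qp p\<^esub> = padic_class p (\<lambda>_. 1)"
    using hom_one by (simp add: padic_Cauchy_ring_def)
  have zero: "\<zero>\<^bsub>Qp p\<^esub> = padic_class p (\<lambda>_. 0)"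
    using hom_zero by (simp add: padic_Cauchy_ring_def)
  have mult: "padic_class p x \<otimes>\<^bsub>Qp p\<^esub> padic_class p y = padic_class p (\<lambda>n. x n * y n)"
    if "x \<in> padic_Cauchy p" "y \<in> padic_Cauchy p" for x y
    using hom_mult[of x y] that by (simp add: padic_Cauchy_ring_def)
  show ?thesis
  proof (rule cring.cring_fieldI2[OF Qp_cring[OF p]])
    show "\<zero>\<^bsub>Qp p\<^esub> \<noteq> \<one>\<^bsub>Qp p\<^esub>"
      unfolding one zero using p by (simp add: padic_class_eq_iff padic_null_iff LIMSEQ_const_iff)
    fix X assume "X \<in> carrier (Qp p)" and nz: "X \<noteq> \<zero>\<^bsub>Qp p\<^esub>"
    then obtain x where x: "x \<in> padic_Cauchy p" "X = padic_class p x" by (auto simp: carrier_Qp)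
    obtain r where r: "(\<lambda>n. padic_abs p (x n)) \<longlonglongrightarrow> r"
      using padic_Cauchy_conv[OF p x(1)] by (auto simp: convergent_def)
    have "r \<noteq> 0"
      using nz r x padic_class_eq_iff[OF p x(1), of "\<lambda>_. 0"] by (auto simp: zero padic_null_iff)
    moreover have "r \<ge> 0" using r by (auto intro: LIMSEQ_le_const)
    ultimately have "r > 0" by simp
    then obtain K where K: "\<And>n. n \<ge> K \<Longrightarrow> padic_abs p (x n) > r / 2"
      using order_tendstoD(1)[OF r, of "r / 2"] by (auto simp: eventually_sequentially)
    have xnz: "x n \<noteq> 0" if "n \<ge> K" for n using K[OF that] \<open>r > 0\<close> by auto
    define y where "y n = inverse (x n)" for n
    have y: "y \<in> padic_Cauchy p"
      unfolding padic_Cauchy_def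
    proof (intro CollectI allI impI)
      fix \<epsilon> :: real assume e: "\<epsilon> > 0"
      then have "\<epsilon> * (r / 2 * (r / 2)) > 0" using \<open>r > 0\<close> by simp
      then obtain N where N: "\<And>m n. m \<ge> N \<Longrightarrow> n \<ge> N \<Longrightarrow> padic_abs p (x m - x n) < \<epsilon> * (r / 2 * (r / 2))"
        using x unfolding padic_Cauchy_def by blast
      have "padic_abs p (y m - y n) < \<epsilon>" if mn: "m \<ge> max N K" "n \<ge> max N K" for m n
      proof -
        have nz': "x m \<noteq> 0" "x n \<noteq> 0" using xnz mn by auto
        have "x n - x m = (y m - y n) * (x m * x n)"
          using nz' by (simp add: y_def field_simps)
        then have eq: "padic_abs p (x n - x m) = padic_abs p (y m - y n) * (padic_abs p (x m) * padic_abs p (x n))"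
          by (simp add: padic_abs_mult[OF p])
        have "padic_abs p (y m - y n) * (r / 2 * (r / 2)) \<le> padic_abs p (x n - x m)"
          unfolding eq using K[of m] K[of n] mn \<open>r > 0\<close>
          by (intro mult_left_mono mult_mono) auto
        also have "\<dots> < \<epsilon> * (r / 2 * (r / 2))" using N mn by simp
        finally show ?thesis using \<open>r > 0\<close> by (simp add: mult_less_cancel_right)
      qed
      then show "\<exists>N. \<forall>m\<ge>N. \<forall>n\<ge>N. padic_abs p (y m - y n) < \<epsilon>" by blast
    qed
    have "eventually (\<lambda>n. padic_abs p (x n * y n - 1) = 0) sequentially"
      using xnz by (auto simp: eventually_sequentially y_def intro!: exI[of _ K])
    then have "(\<lambda>n. x n * y n - 1) \<in> padic_null p"
      unfolding padic_null_iff by (simp add: tendsto_eventually)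
    then have "X \<otimes>\<^bsub>Qp p\<^esub> padic_class p y = \<one>\<^bsub>Qp p\<^esub>"
      using x y by (simp add: mult one padic_class_eq_iff[OF p] padic_Cauchy_mult[OF p])
    then show "\<exists>Y\<in>carrier (Qp p). X \<otimes>\<^bsub>Qp p\<^esub> Y = \<one>\<^bsub>Qp p\<^esub>"
      using y by (auto simp: carrier_Qp)
  qed
qed


section \<open>Stirling numbers, binomial coefficients and their p-adic limits\<close>

definition Stirling_int :: "int \<Rightarrow> int \<Rightarrow> int" where
  "Stirling_int n k = (if 0 \<le> n \<and> 0 \<le> k then int (Stirling (nat n) (nat k)) else 0)"

text \<open>Convention: the binomial coefficient vanishes unless \<open>0 \<le> k \<le> n\<close>, so also for
  \<open>n = -1\<close>, \<open>k = 0\<close>. This matters below only for \<open>\<alpha> = \<beta> = 0\<close>, where the value is then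
  that of the case \<open>\<alpha> = \<beta> > 0\<close>.\<close>

definition binomial_int :: "int \<Rightarrow> int \<Rightarrow> int" where
  "binomial_int n k = (if 0 \<le> k \<and> k \<le> n then int (nat n choose nat k) else 0)"

definition partial_Stirling :: "nat \<Rightarrow> int \<Rightarrow> nat \<Rightarrow> rat" where
  "partial_Stirling p n k =
     (-1) ^ k / fact k *
       (\<Sum>i | i \<le> k \<and> \<not> [i = 0] (mod p). (-1) ^ i * of_nat (k choose i) * of_nat i powi n)"

definition Stirling_seq :: "nat \<Rightarrow> int \<Rightarrow> int \<Rightarrow> int \<Rightarrow> int \<Rightarrow> nat \<Rightarrow> int" where
  "Stirling_seq p a c b d e = Stirling_int (int p ^ e * a + c) (int p ^ e * b + d)"

definition binomial_seq :: "nat \<Rightarrow> int \<Rightarrow> int \<Rightarrow> nat \<Rightarrow> int" where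
  "binomial_seq p \<alpha> \<beta> e = binomial_int (int p ^ e * \<alpha> - 1) (int p ^ e * \<beta>)"

text \<open>\<open>S(p\<^sup>\<infinity> a + c, p\<^sup>\<infinity> b + d)\<close>\<close>

definition padic_Stirling :: "nat \<Rightarrow> int \<Rightarrow> int \<Rightarrow> int \<Rightarrow> int \<Rightarrow> (nat \<Rightarrow> rat) set" where
  "padic_Stirling p a c b d = padic_lim p (Stirling_seq p a c b d)"

text \<open>The binomial coefficient of \<open>p\<^sup>\<infinity> \<alpha> - 1\<close> over \<open>p\<^sup>\<infinity> \<beta>\<close>\<close>

definition padic_binomial :: "nat \<Rightarrow> int \<Rightarrow> int \<Rightarrow> (nat \<Rightarrow> rat) set" where
  "padic_binomial p \<alpha> \<beta> = padic_lim p (binomial_seq p \<alpha> \<beta>)"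

end

theory Submission
  imports Defs "HOL-Number_Theory.Residues" "HOL-Computational_Algebra.Formal_Power_Series"
begin

text \<open>Put \<open>P\<^sub>k = (1 - X)(1 - 2X)\<cdots>(1 - kX)\<close>, so that \<open>\<Sum> S(n + k, k) X\<^sup>n = 1 / P\<^sub>k\<close> in the integral
  power series. From \<open>P\<^sub>p \<equiv> 1 - X\<^bsup>p-1\<^esup>\<close> modulo \<open>p\<close>, raising to \<open>p\<close>-th powers gives
  \<open>P\<^sub>k \<equiv> (1 - X\<^bsup>p-1\<^esup>)\<^bsup>N\<^esup> P\<^sub>d\<close> modulo \<open>p\<^sup>e\<close> for \<open>k = p\<^bsup>e+1\<^esup> b + d\<close> and \<open>N = p\<^sup>e b\<close>. With
  \<open>a - b = (p - 1) c\<close> and \<open>J = p\<^bsup>e+1\<^esup> c\<close>, comparing coefficients yields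
  \<open>S(p\<^bsup>e+1\<^esup> a + d - 1, k) \<equiv> \<Sum>\<^bsub>j<J\<^esub> binom(N + j - 1, j) S((p - 1)(J - j) + d - 1, d)\<close>.
  Here \<open>p\<^sup>e\<close> divides \<open>j binom(N + j - 1, j)\<close>, so only the \<open>j\<close> divisible by a high power of \<open>p\<close>
  matter, and for these the Stirling number is close to \<open>T\<^sub>p(d - 1, d)\<close>, because by Euler's theorem
  \<open>i\<^bsup>(p-1)(J-j)\<^esup>\<close> is close to 0 or 1 according as \<open>p\<close> divides \<open>i\<close> or not. The remaining sum of the
  binomial coefficients is \<open>binom(p\<^sup>e (b + p c) - 1, p\<^sup>e b)\<close>.\<close>

unbundle no vec_syntax
unbundle fps_syntax

section \<open>Congruences in commutative rings\<close>

text \<open>Defined for every commutative ring, so that the same rules serve for integers and for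
  integral power series.\<close>

definition dvd_cong :: "'a::comm_ring_1 \<Rightarrow> 'a \<Rightarrow> 'a \<Rightarrow> bool" where
  "dvd_cong m x y \<longleftrightarrow> m dvd x - y"

lemma dvd_cong_refl [simp]: "dvd_cong m x x"
  by (simp add: dvd_cong_def)

lemma dvd_cong_sym: "dvd_cong m x y \<Longrightarrow> dvd_cong m y x"
  unfolding dvd_cong_def by (subst minus_diff_eq[symmetric]) (simp only: dvd_minus_iff)

lemma dvd_cong_trans [trans]: "dvd_cong m x y \<Longrightarrow> dvd_cong m y z \<Longrightarrow> dvd_cong m x z"
  unfolding dvd_cong_def using dvd_add[of m "x - y" "y - z"] by simp

lemma dvd_cong_mult:
  assumes "dvd_cong m x y" "dvd_cong m u v"
  shows "dvd_cong m (x * u) (y * v)"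
proof -
  have "x * u - y * v = (x - y) * u + y * (u - v)" by (simp add: algebra_simps)
  with assms show ?thesis by (simp add: dvd_cong_def)
qed

lemma dvd_cong_power: "dvd_cong m x y \<Longrightarrow> dvd_cong m (x ^ k) (y ^ k)"
  by (induction k) (simp_all add: dvd_cong_mult)

lemma dvd_cong_prod: "(\<And>i. i \<in> I \<Longrightarrow> dvd_cong m (f i) (g i)) \<Longrightarrow> dvd_cong m (prod f I) (prod g I)"
  by (induction I rule: infinite_finite_induct) (simp_all add: dvd_cong_mult)

lemma dvd_cong_sum: "(\<And>i. i \<in> I \<Longrightarrow> dvd_cong m (f i) (g i)) \<Longrightarrow> dvd_cong m (sum f I) (sum g I)"
  unfolding dvd_cong_def sum_subtractf[symmetric] by (rule dvd_sum)

lemma dvd_cong_dvd: "dvd_cong m x y \<Longrightarrow> n dvd m \<Longrightarrow> dvd_cong n x y"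
  unfolding dvd_cong_def by (rule dvd_trans)

text \<open>In \<open>x^p - y^p = (x - y) * (\<Sum>i<p. x^i * y^(p-1-i))\<close> the second factor
  is congruent to \<open>p * y^(p-1)\<close>, hence to 0, modulo \<open>p\<close>. Each
  \<open>p\<close>-th power thus gains one factor \<open>p\<close>.\<close>

lemma dvd_cong_power_prime_lift:
  assumes "dvd_cong (of_nat p ^ Suc k) x y"
  shows "dvd_cong (of_nat p ^ Suc (Suc k)) (x ^ p) (y ^ p)"
proof -
  have "dvd_cong (of_nat p) x y"
    using assms by (rule dvd_cong_dvd) simp
  then have "dvd_cong (of_nat p) (\<Sum>i<p. x ^ i * y ^ (p - Suc i)) (\<Sum>i<p. y ^ i * y ^ (p - Suc i))"
    by (intro dvd_cong_sum dvd_cong_mult dvd_cong_power) simp_all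
  also have "(\<Sum>i<p. y ^ i * y ^ (p - Suc i)) = (\<Sum>i<p. y ^ (p - 1))"
    by (intro sum.cong refl) (simp flip: power_add)
  also have "dvd_cong (of_nat p) \<dots> 0"
    by (simp add: dvd_cong_def)
  finally have "of_nat p dvd (\<Sum>i<p. y ^ (p - Suc i) * x ^ i)"
    by (simp add: dvd_cong_def mult.commute)
  then have "of_nat p ^ Suc k * of_nat p dvd (x - y) * (\<Sum>i<p. y ^ (p - Suc i) * x ^ i)"
    using assms unfolding dvd_cong_def by (rule mult_dvd_mono[rotated])
  then show ?thesis
    by (simp only: dvd_cong_def power_diff_sumr2 power_Suc2)
qed

lemma dvd_cong_fps_nth:
  assumes "dvd_cong (of_nat m) f g"
  shows "dvd_cong (of_nat m) (f $ n) (g $ n)"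
proof -
  obtain h where "f - g = of_nat m * h"
    using assms by (auto simp: dvd_cong_def)
  then have "f $ n - g $ n = of_nat m * h $ n"
    by (metis fps_mult_left_const_nth fps_of_nat fps_sub_nth)
  then show ?thesis by (simp add: dvd_cong_def)
qed

lemma dvd_cong_fpsI:
  assumes "\<And>n. dvd_cong (of_nat m) (f $ n) (g $ n)"
  shows "dvd_cong (of_nat m) f g"
proof -
  have "\<exists>c. f $ n - g $ n = of_nat m * c" for n
    using assms[of n] by (auto simp: dvd_cong_def)
  then obtain h where "\<And>n. f $ n - g $ n = of_nat m * h n" by metis
  then have "f - g = fps_const (of_nat m) * Abs_fps h"
    by (intro fps_ext) simp
  then show ?thesis by (simp add: dvd_cong_def fps_of_nat)
qed

section \<open>Stirling numbers: closed form and generating function\<close>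

text \<open>The identity \<open>i * binom(k,i) = k * (binom(k,i) - binom(k-1,i))\<close> gives the
  sum on the right the recurrence of the Stirling numbers. The factor \<open>k!\<close> stays on the
  left to remain in the integers.\<close>

lemma Stirling_closed_form:
  "(-1) ^ k * fact k * int (Stirling n k) = (\<Sum>i\<le>k. (-1) ^ i * int (k choose i) * int i ^ n)"
proof (induction n arbitrary: k)
  case 0
  have "(\<Sum>i\<le>k. (-1) ^ i * int (k choose i)) = (if k = 0 then 1 else 0)"
    using choose_alternating_sum[of k, where ?'a = int] by (cases k) auto
  then show ?case by (cases k) auto
next
  case (Suc n)
  show ?case
  proof (cases k)
    case (Suc l)
    have "int (Suc l choose i) * int i = int (Suc l) * (int (Suc l choose i) - int (l choose i))" for i
    proof (cases i)
      case (Suc j)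
      have "Suc j * (Suc l choose Suc j) = Suc l * (l choose j)"
        using Suc_times_binomial_eq[of l j] by (simp add: mult.commute)
      then have "int (Suc j) * int (Suc l choose Suc j) = int (Suc l) * int (l choose j)"
        by (simp only: flip: of_nat_mult)
      then show ?thesis using Suc by (simp add: mult.commute)
    qed simp
    note absorb = this
    have "(-1) ^ i * int (Suc l choose i) * int i ^ Suc n
        = int (Suc l) * ((-1) ^ i * int (Suc l choose i) * int i ^ n)
          - int (Suc l) * ((-1) ^ i * int (l choose i) * int i ^ n)" for i
    proof -
      have "(-1) ^ i * int (Suc l choose i) * int i ^ Suc n
          = (-1) ^ i * int i ^ n * (int (Suc l choose i) * int i)" by simp
      also have "\<dots> = int (Suc l) * ((-1) ^ i * int (Suc l choose i) * int i ^ n)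
          - int (Suc l) * ((-1) ^ i * int (l choose i) * int i ^ n)"
        unfolding absorb by (simp only: algebra_simps)
      finally show ?thesis .
    qed
    then have "(\<Sum>i\<le>Suc l. (-1) ^ i * int (Suc l choose i) * int i ^ Suc n)
        = int (Suc l) * (\<Sum>i\<le>Suc l. (-1) ^ i * int (Suc l choose i) * int i ^ n)
          - int (Suc l) * (\<Sum>i\<le>Suc l. (-1) ^ i * int (l choose i) * int i ^ n)"
      by (simp only: sum_subtractf sum_distrib_left)
    also have "(\<Sum>i\<le>Suc l. (-1) ^ i * int (l choose i) * int i ^ n)
        = (\<Sum>i\<le>l. (-1) ^ i * int (l choose i) * int i ^ n)"
      by simp
    finally show ?thesis
      unfolding Suc Suc.IH[symmetric] by (simp add: algebra_simps)
  qed simp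
qed

text \<open>The polynomial \<open>P\<^sub>k\<close> of the overview; \<open>Suc\<close> makes its
  factors run from \<open>1 - X\<close> to \<open>1 - kX\<close>.\<close>

definition Stirling_denom :: "nat \<Rightarrow> int fps" where
  "Stirling_denom k = (\<Prod>i<k. 1 - of_nat (Suc i) * fps_X)"

definition Stirling_gf :: "nat \<Rightarrow> int fps" where
  "Stirling_gf k = Abs_fps (\<lambda>n. int (Stirling (n + k) k))"

text \<open>Multiplication by \<open>1 - (k+1)X\<close> turns the series for \<open>k + 1\<close>
  into that for \<open>k\<close>: this is the recurrence
  \<open>S(m+1,k+1) = (k+1) S(m,k+1) + S(m,k)\<close>.\<close>

lemma Stirling_gf_mult_denom: "Stirling_gf k * Stirling_denom k = 1"
proof (induction k)
  case 0
  show ?case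
    by (rule fps_ext) (auto simp: Stirling_gf_def Stirling_denom_def gr0_conv_Suc)
next
  case (Suc k)
  have "Stirling_gf (Suc k) * (1 - of_nat (Suc k) * fps_X) = Stirling_gf k"
  proof (rule fps_ext)
    fix n
    have "(Stirling_gf (Suc k) * (1 - of_nat (Suc k) * fps_X)) $ n
        = Stirling_gf (Suc k) $ n - int (Suc k) * (fps_X * Stirling_gf (Suc k)) $ n"
      unfolding fps_of_nat[symmetric] by (simp add: algebra_simps del: of_nat_Suc)
    also have "\<dots> = Stirling_gf k $ n"
      by (cases n) (simp_all add: Stirling_gf_def algebra_simps)
    finally show "(Stirling_gf (Suc k) * (1 - of_nat (Suc k) * fps_X)) $ n = Stirling_gf k $ n" .
  qed
  moreover have "Stirling_denom (Suc k) = (1 - of_nat (Suc k) * fps_X) * Stirling_denom k"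
    by (simp add: Stirling_denom_def mult.commute)
  ultimately show ?case
    using Suc by (simp only: mult.assoc[symmetric])
qed

section \<open>The denominators modulo prime powers\<close>

lemma dvd_cong_cancel_prime_int:
  assumes "prime p" "\<not> int p dvd c" "dvd_cong (int p) (c * x) (c * y)"
  shows "dvd_cong (int p) x y"
  using assms by (simp add: dvd_cong_def prime_dvd_mult_iff flip: right_diff_distrib)

text \<open>Since \<open>(p-1)!\<close> is prime to \<open>p\<close>, it suffices to compare the
  closed forms. There Fermat's theorem handles the \<open>i\<close> prime to \<open>p\<close>, and
  \<open>n > 0\<close> makes both powers vanish modulo \<open>p\<close> for the others.\<close>

lemma Stirling_prime_minus_1_periodic:
  assumes p: "prime p" and n: "n > 0"
  shows "dvd_cong (int p) (int (Stirling (n + (p - 1)) (p - 1))) (int (Stirling n (p - 1)))"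
proof (rule dvd_cong_cancel_prime_int[OF p])
  show "\<not> int p dvd (-1) ^ (p - 1) * fact (p - 1)"
  proof
    assume "int p dvd (-1) ^ (p - 1) * fact (p - 1)"
    moreover have "coprime (int p) ((-1) ^ (p - 1))" by simp
    ultimately have "int p dvd int (fact (p - 1))"
      by (simp add: coprime_dvd_mult_right_iff)
    then have "p dvd fact (p - 1)" by (simp only: of_nat_dvd_iff)
    then show False using p prime_gt_0_nat[OF p] by (simp add: prime_dvd_fact_iff)
  qed
  have "dvd_cong (int p) (int i ^ (n + (p - 1))) (int i ^ n)" for i
  proof (cases "p dvd i")
    case True
    then have "int p dvd int i ^ (n + (p - 1))" "int p dvd int i ^ n"
      using n by (auto intro: dvd_power_le[of _ _ 1, simplified] dvd_trans[OF _ dvd_power])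
    then show ?thesis by (simp add: dvd_cong_def)
  next
    case False
    then have "[int (i ^ (p - 1)) = int 1] (mod int p)"
      using p fermat_theorem cong_int_iff by blast
    then have "dvd_cong (int p) (int i ^ (p - 1)) 1"
      by (simp add: dvd_cong_def cong_iff_dvd_diff)
    then have "dvd_cong (int p) (int i ^ n * int i ^ (p - 1)) (int i ^ n * 1)"
      by (intro dvd_cong_mult) simp_all
    then show ?thesis by (simp add: power_add)
  qed
  then show "dvd_cong (int p) ((-1) ^ (p - 1) * fact (p - 1) * int (Stirling (n + (p - 1)) (p - 1)))
       ((-1) ^ (p - 1) * fact (p - 1) * int (Stirling n (p - 1)))"
    unfolding Stirling_closed_form by (intro dvd_cong_sum dvd_cong_mult) simp_all
qed

text \<open>Periodicity says that the generating function times \<open>1 - X^(p-1)\<close> is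
  congruent to 1; multiplying by the denominator, its inverse, gives the claim.\<close>

lemma Stirling_denom_prime_minus_1:
  assumes p: "prime p"
  shows "dvd_cong (of_nat p) (Stirling_denom (p - 1)) (1 - fps_X ^ (p - 1))"
proof -
  let ?H = "Stirling_gf (p - 1)" and ?P = "Stirling_denom (p - 1)" and ?Q = "1 - fps_X ^ (p - 1) :: int fps"
  have p1: "p > 1" using p by (rule prime_gt_1_nat)
  have "dvd_cong (of_nat p) (?H * ?Q) 1"
  proof (rule dvd_cong_fpsI)
    fix n
    have eq: "(?H * ?Q) $ n = ?H $ n - (if n < p - 1 then 0 else ?H $ (n - (p - 1)))"
      by (simp add: right_diff_distrib fps_X_power_mult_right_nth)
    show "dvd_cong (of_nat p) ((?H * ?Q) $ n) (1 $ n)"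
    proof (cases "n = 0")
      case True
      then show ?thesis unfolding eq using p1 by (simp add: Stirling_gf_def)
    next
      case False
      \<comment> \<open>For \<open>0 < n < p - 1\<close> this holds because
        \<open>S(n, p-1) = 0\<close>, so periodicity covers the first coefficients too.\<close>
      then have "(if n < p - 1 then 0 else ?H $ (n - (p - 1))) = int (Stirling n (p - 1))"
        by (simp add: Stirling_gf_def)
      with False Stirling_prime_minus_1_periodic[OF p, of n] show ?thesis
        unfolding eq by (simp add: dvd_cong_def Stirling_gf_def)
    qed
  qed
  from dvd_cong_mult[OF dvd_cong_refl[of _ ?P] this] have "dvd_cong (of_nat p) (?P * (?H * ?Q)) ?P" by simp
  also have "?P * (?H * ?Q) = ?H * ?P * ?Q" by (simp only: mult_ac)
  finally show ?thesis by (simp add: Stirling_gf_mult_denom dvd_cong_sym)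
qed

text \<open>Modulo \<open>N\<close> the factor \<open>1 - iX\<close> depends only on the residue of
  \<open>i\<close>, so the factors fall into \<open>k\<close> full blocks of length \<open>N\<close>
  and one initial piece of length \<open>d\<close>.\<close>

lemma Stirling_denom_shift:
  "dvd_cong (of_nat N) (Stirling_denom (N * k + d)) (Stirling_denom N ^ k * Stirling_denom d)"
proof -
  let ?f = "\<lambda>i. 1 - of_nat (Suc i) * fps_X :: int fps"
  have shift: "dvd_cong (of_nat N) (?f (i + N * r)) (?f i)" for i r
    by (simp add: dvd_cong_def algebra_simps)
  have *: "dvd_cong (of_nat N) (\<Prod>i<l. ?f (i + N * r)) (Stirling_denom l)" for l r
    unfolding Stirling_denom_def by (intro dvd_cong_prod shift)
  have split: "Stirling_denom (N * r + l) = Stirling_denom (N * r) * (\<Prod>i<l. ?f (i + N * r))" for r l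
    by (induction l) (simp_all add: Stirling_denom_def add.commute mult.assoc)
  have "dvd_cong (of_nat N) (Stirling_denom (N * k)) (Stirling_denom N ^ k)"
  proof (induction k)
    case (Suc k)
    have "Stirling_denom (N * Suc k) = Stirling_denom (N * k) * (\<Prod>i<N. ?f (i + N * k))"
      using split[of k N] by (simp add: add.commute)
    also have "dvd_cong (of_nat N) \<dots> (Stirling_denom N ^ k * Stirling_denom N)"
      by (intro dvd_cong_mult Suc *)
    finally show ?case by (simp add: mult.commute)
  qed (simp add: Stirling_denom_def)
  then show ?thesis unfolding split by (intro dvd_cong_mult *)
qed

lemma Stirling_denom_prime:
  assumes p: "prime p"
  shows "dvd_cong (of_nat p) (Stirling_denom p) (1 - fps_X ^ (p - 1))"
proof -
  obtain q where q: "p = Suc q" using prime_gt_0_nat[OF p] gr0_conv_Suc by auto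
  have "Stirling_denom p = Stirling_denom (p - 1) * (1 - of_nat p * fps_X)"
    by (simp add: Stirling_denom_def q)
  also have "dvd_cong (of_nat p) \<dots> ((1 - fps_X ^ (p - 1)) * 1)"
    by (intro dvd_cong_mult Stirling_denom_prime_minus_1 p) (simp add: dvd_cong_def)
  finally show ?thesis by simp
qed

text \<open>Going from \<open>e\<close> to \<open>e + 1\<close>, the block decomposition replaces
  the new denominator by the \<open>p\<close>-th power of the old one modulo \<open>p^(e+1)\<close>,
  and taking \<open>p\<close>-th powers raises the modulus of the induction hypothesis by one factor
  \<open>p\<close>.\<close>

lemma Stirling_denom_prime_power:
  assumes p: "prime p"
  shows "dvd_cong (of_nat (p ^ e)) (Stirling_denom (p ^ Suc e)) ((1 - fps_X ^ (p - 1)) ^ (p ^ e))"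
proof (induction e)
  case 0
  show ?case by (simp add: dvd_cong_def)
next
  case (Suc e)
  have "Stirling_denom (p ^ Suc (Suc e)) = Stirling_denom (p ^ Suc e * p + 0)"
    by (simp add: mult.commute)
  also have "dvd_cong (of_nat (p ^ Suc e)) \<dots> (Stirling_denom (p ^ Suc e) ^ p * Stirling_denom 0)"
    by (rule Stirling_denom_shift)
  finally have 1: "dvd_cong (of_nat (p ^ Suc e)) (Stirling_denom (p ^ Suc (Suc e))) (Stirling_denom (p ^ Suc e) ^ p)"
    by (simp add: Stirling_denom_def)
  have 2: "dvd_cong (of_nat (p ^ Suc e)) (Stirling_denom (p ^ Suc e) ^ p) ((1 - fps_X ^ (p - 1)) ^ p ^ Suc e)"
  \<comment> \<open>For \<open>e = 0\<close> the induction hypothesis is modulo 1 and cannot be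
    lifted; the congruence modulo \<open>p\<close> for \<open>P\<^sub>p\<close> takes its
    place.\<close>
  proof (cases e)
    case 0
    then show ?thesis using dvd_cong_power[OF Stirling_denom_prime[OF p], of p] by simp
  next
    case (Suc e')
    then show ?thesis
      using dvd_cong_power_prime_lift[of p e' "Stirling_denom (p ^ Suc e)" "(1 - fps_X ^ (p - 1)) ^ p ^ e"] Suc.IH
      by (simp add: mult.commute flip: power_mult)
  qed
  from 1 2 show ?case by (rule dvd_cong_trans)
qed

section \<open>Negative powers of \<open>1 - X^q\<close> and comparison of coefficients\<close>

text \<open>The expansion of \<open>(1 - X^q)^(-N)\<close>. For \<open>N = 0\<close> the truncated
  subtraction still gives the right values: 1 at \<open>n = 0\<close> and
  \<open>binom(j-1, j) = 0\<close> at \<open>n = qj > 0\<close>.\<close>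

definition power_gf :: "nat \<Rightarrow> nat \<Rightarrow> int fps" where
  "power_gf q N = Abs_fps (\<lambda>n. if q dvd n then int ((N + n div q - 1) choose (n div q)) else 0)"

text \<open>By Pascal's rule, multiplication by \<open>1 - X^q\<close> lowers \<open>N + 1\<close>
  to \<open>N\<close>.\<close>

lemma power_gf_inverse:
  assumes q: "q > 0"
  shows "power_gf q N * (1 - fps_X ^ q) ^ N = 1"
proof (induction N)
  case 0
  show ?case
    using q by (auto simp: power_gf_def fps_eq_iff elim!: dvdE)
next
  case (Suc N)
  have "power_gf q (Suc N) * (1 - fps_X ^ q) = power_gf q N"
  proof (rule fps_ext)
    fix n
    have eq: "(power_gf q (Suc N) * (1 - fps_X ^ q)) $ n
        = power_gf q (Suc N) $ n - (if n < q then 0 else power_gf q (Suc N) $ (n - q))"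
      by (simp add: right_diff_distrib fps_X_power_mult_right_nth)
    show "(power_gf q (Suc N) * (1 - fps_X ^ q)) $ n = power_gf q N $ n"
    proof (cases "q dvd n")
      case True
      then obtain j where j: "n = q * j" by blast
      show ?thesis
      proof (cases j)
        case 0
        then show ?thesis unfolding eq using q by (simp add: power_gf_def j)
      next
        case (Suc i)
        have "n - q = q * i" "\<not> n < q" by (simp_all add: j Suc)
        then show ?thesis unfolding eq using q by (simp add: power_gf_def j Suc)
      qed
    next
      case False
      moreover from this have "\<not> q dvd n - q" if "q \<le> n"
        using that by (simp add: dvd_minus_self)
      ultimately show ?thesis unfolding eq by (simp add: power_gf_def)
    qed
  qed
  then show ?case
    using Suc by (simp add: mult.assoc[symmetric])
qed

text \<open>Only exponents \<open>qj\<close> contribute, and \<open>Suc n = q * J\<close> makes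
  \<open>q * j \<le> n\<close> equivalent to \<open>j < J\<close>.\<close>

lemma power_gf_mult_nth:
  assumes q: "q > 0" and n: "Suc n = q * J"
  shows "(power_gf q N * h) $ n = (\<Sum>j<J. int ((N + j - 1) choose j) * h $ (n - q * j))"
proof -
  have "(power_gf q N * h) $ n = (\<Sum>i=0..n. power_gf q N $ i * h $ (n - i))"
    by (rule fps_mult_nth)
  also have "\<dots> = (\<Sum>i\<in>(*) q ` {..<J}. power_gf q N $ i * h $ (n - i))"
  proof (rule sum.mono_neutral_right)
    have "q * j \<le> n" if "j < J" for j
    proof -
      have "q * Suc j \<le> q * J" using that by (intro mult_le_mono) auto
      then show ?thesis using q n by simp
    qed
    then show "(*) q ` {..<J} \<subseteq> {0..n}" by auto
    show "\<forall>i\<in>{0..n} - (*) q ` {..<J}. power_gf q N $ i * h $ (n - i) = 0"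
    proof
      fix i assume i: "i \<in> {0..n} - (*) q ` {..<J}"
      have "\<not> q dvd i"
      proof
        assume "q dvd i"
        then obtain j where j: "i = q * j" by blast
        then have "q * j < q * J" using i unfolding n[symmetric] by simp
        then have "j < J" by (simp only: mult_less_cancel1)
        then show False using i j by blast
      qed
      then show "power_gf q N $ i * h $ (n - i) = 0" by (simp add: power_gf_def)
    qed
  qed simp
  also have "\<dots> = (\<Sum>j<J. power_gf q N $ (q * j) * h $ (n - q * j))"
    using q by (subst sum.reindex) (auto simp: inj_on_def)
  also have "\<dots> = (\<Sum>j<J. int ((N + j - 1) choose j) * h $ (n - q * j))"
    using q by (intro sum.cong) (auto simp: power_gf_def)
  finally show ?thesis .
qed

lemma Stirling_gf_prime_power:
  assumes p: "prime p"
  shows "dvd_cong (of_nat (p ^ e)) (Stirling_gf (p ^ Suc e * b + d))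
           (power_gf (p - 1) (p ^ e * b) * Stirling_gf d)"
proof -
  let ?k = "p ^ Suc e * b + d" and ?Q = "1 - fps_X ^ (p - 1) :: int fps" and ?N = "p ^ e * b"
  let ?G = "power_gf (p - 1) ?N"
  have q: "p - 1 > 0" using prime_gt_1_nat[OF p] by simp
  have "dvd_cong (of_nat (p ^ e)) (Stirling_denom ?k) (Stirling_denom (p ^ Suc e) ^ b * Stirling_denom d)"
    by (rule dvd_cong_dvd[OF Stirling_denom_shift]) (simp flip: of_nat_power)
  also have "dvd_cong (of_nat (p ^ e)) \<dots> ((?Q ^ (p ^ e)) ^ b * Stirling_denom d)"
    by (intro dvd_cong_mult dvd_cong_power Stirling_denom_prime_power p dvd_cong_refl)
  finally have "dvd_cong (of_nat (p ^ e)) (Stirling_denom ?k) (?Q ^ ?N * Stirling_denom d)"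
    by (simp add: power_mult)
  \<comment> \<open>Multiplying the congruence of the denominators by both of their inverses leaves
    one inverse on each side.\<close>
  then have "dvd_cong (of_nat (p ^ e)) (Stirling_gf ?k * Stirling_denom ?k * (?G * Stirling_gf d))
     (Stirling_gf ?k * (?Q ^ ?N * Stirling_denom d) * (?G * Stirling_gf d))"
    by (intro dvd_cong_mult) simp_all
  also have "Stirling_gf ?k * (?Q ^ ?N * Stirling_denom d) * (?G * Stirling_gf d)
     = Stirling_gf ?k * (?G * ?Q ^ ?N) * (Stirling_gf d * Stirling_denom d)"
    by (simp only: mult_ac)
  finally show ?thesis
    unfolding Stirling_gf_mult_denom power_gf_inverse[OF q] by (simp add: dvd_cong_sym)
qed

lemma Stirling_prime_power_cong:
  fixes p b c d e :: nat
  assumes p: "prime p" and c: "c > 0" and d: "d > 0"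
  defines "J \<equiv> p ^ Suc e * c"
  shows "dvd_cong (int (p ^ e)) (int (Stirling (p ^ Suc e * (b + (p - 1) * c) + (d - 1)) (p ^ Suc e * b + d)))
     (\<Sum>j<J. int ((p ^ e * b + j - 1) choose j) * int (Stirling ((p - 1) * (J - j) + (d - 1)) d))"
proof -
  have q: "p - 1 > 0" and p0: "p > 0" using prime_gt_1_nat[OF p] by simp_all
  \<comment> \<open>The coefficient to compare: adding the lower index \<open>p^(e+1) b + d\<close>
    to \<open>n\<close> gives the upper index \<open>p^(e+1) a + d - 1\<close> with
    \<open>a = b + (p-1)c\<close>. Here \<open>c > 0\<close> ensures that \<open>n\<close> is a true
    difference.\<close>
  define n where "n = (p - 1) * J - 1"
  have J: "J > 0" using c p0 by (simp add: J_def)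
  have n: "Suc n = (p - 1) * J" using J q by (simp add: n_def)
  have "n + (p ^ Suc e * b + d) = p ^ Suc e * (b + (p - 1) * c) + (d - 1)"
    using n d by (simp add: J_def algebra_simps)
  then have lhs: "Stirling_gf (p ^ Suc e * b + d) $ n
      = int (Stirling (p ^ Suc e * (b + (p - 1) * c) + (d - 1)) (p ^ Suc e * b + d))"
    by (simp add: Stirling_gf_def)
  have "n - (p - 1) * j + d = (p - 1) * (J - j) + (d - 1)" if "j < J" for j
  proof -
    have "(p - 1) * j + (p - 1) * (J - j) = Suc n"
      using that n by (simp flip: distrib_left)
    moreover have "(p - 1) * (J - j) > 0" using that q by simp
    ultimately show ?thesis using d by linarith
  qed
  then have rhs: "(power_gf (p - 1) (p ^ e * b) * Stirling_gf d) $ n =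
     (\<Sum>j<J. int ((p ^ e * b + j - 1) choose j) * int (Stirling ((p - 1) * (J - j) + (d - 1)) d))"
    unfolding power_gf_mult_nth[OF q n] by (intro sum.cong refl) (simp add: Stirling_gf_def)
  show ?thesis
    using dvd_cong_fps_nth[OF Stirling_gf_prime_power[OF p], of e b d n] unfolding lhs rhs .
qed

section \<open>Reduction to partial Stirling numbers\<close>

text \<open>This is \<open>(-1)^k k! T\<^sub>p(n,k)\<close>, an integer because the exponent is a
  natural number.\<close>

definition partial_Stirling_num :: "nat \<Rightarrow> nat \<Rightarrow> nat \<Rightarrow> int" where
  "partial_Stirling_num p n k = (\<Sum>i | i \<le> k \<and> \<not> p dvd i. (-1) ^ i * int (k choose i) * int i ^ n)"

lemma prime_power_exponent_le:
  fixes p f m :: nat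
  assumes "prime p" "p ^ f dvd m" "m > 0"
  shows "f \<le> m"
proof -
  have "f < p ^ f" using prime_gt_1_nat[OF assms(1)] by (simp add: power_gt_expt)
  also have "\<dots> \<le> m" using assms by (intro dvd_imp_le)
  finally show ?thesis by simp
qed

text \<open>The closed forms agree term by term: if \<open>p\<close> divides \<open>i\<close>, the
  exponent is at least \<open>m \<ge> p^f > f\<close> and the power vanishes; otherwise Euler's
  theorem removes \<open>(p-1)m\<close> from the exponent.\<close>

lemma Stirling_partial_cong:
  assumes p: "prime p" and m: "m > 0" "p ^ f dvd m"
  shows "dvd_cong (int (p ^ f)) ((-1) ^ k * fact k * int (Stirling ((p - 1) * m + n) k))
           (partial_Stirling_num p n k)"
proof -
  have p1: "p > 1" using p by (rule prime_gt_1_nat)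
  have "dvd_cong (int (p ^ f)) (int i ^ ((p - 1) * m + n)) (if p dvd i then 0 else int i ^ n)" for i
  proof (cases "p dvd i")
    case True
    have "f \<le> m" using prime_power_exponent_le[OF p m(2,1)] .
    also have "m \<le> (p - 1) * m" using p1 by (cases p) auto
    also have "\<dots> \<le> (p - 1) * m + n" by simp
    finally have "int p ^ f dvd int i ^ ((p - 1) * m + n)"
      using True by (intro dvd_power_le) simp_all
    then show ?thesis using True by (simp add: dvd_cong_def)
  next
    case False
    \<comment> \<open>The modulus \<open>p^(f+1)\<close> is chosen because its totient
      \<open>(p-1) p^f\<close> divides \<open>(p-1)m\<close>, also for \<open>f = 0\<close>.\<close>
    then have "coprime i (p ^ Suc f)"
      using p by (metis coprime_commute coprime_power_right_iff prime_imp_coprime)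
    then have "[i ^ totient (p ^ Suc f) = 1] (mod p ^ Suc f)" by (rule euler_theorem)
    then have "[int (i ^ totient (p ^ Suc f)) = int 1] (mod int (p ^ Suc f))"
      by (simp only: cong_int_iff)
    then have "dvd_cong (int (p ^ Suc f)) (int i ^ totient (p ^ Suc f)) 1"
      by (simp add: dvd_cong_def cong_iff_dvd_diff)
    then have base: "dvd_cong (int (p ^ f)) (int i ^ totient (p ^ Suc f)) 1"
      by (rule dvd_cong_dvd) simp
    obtain r where r: "m = p ^ f * r" using m by blast
    have "(p - 1) * m = totient (p ^ Suc f) * r"
      unfolding totient_prime_power_Suc[OF p] r by (simp only: mult_ac)
    then have "dvd_cong (int (p ^ f)) (int i ^ ((p - 1) * m)) (1 ^ r)"
      using dvd_cong_power[OF base, of r] by (simp only: power_mult)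
    from dvd_cong_mult[OF this dvd_cong_refl, of "int i ^ n"] show ?thesis
      using False by (simp add: power_add)
  qed
  then have "dvd_cong (int (p ^ f)) (\<Sum>i\<le>k. (-1) ^ i * int (k choose i) * int i ^ ((p - 1) * m + n))
     (\<Sum>i\<le>k. (-1) ^ i * int (k choose i) * (if p dvd i then 0 else int i ^ n))"
    by (intro dvd_cong_sum dvd_cong_mult dvd_cong_refl)
  also have "(\<Sum>i\<le>k. (-1) ^ i * int (k choose i) * (if p dvd i then 0 else int i ^ n)) = partial_Stirling_num p n k"
    unfolding partial_Stirling_num_def by (intro sum.mono_neutral_cong_right) auto
  finally show ?thesis unfolding Stirling_closed_form .
qed

lemma prime_power_dvd_factor:
  fixes x y p :: nat
  assumes p: "prime p" and dvd: "p ^ (f + g) dvd x * y" and x: "\<not> p ^ f dvd x"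
  shows "p ^ g dvd y"
proof (cases "y = 0")
  case False
  have x0: "x \<noteq> 0" using x by (metis dvd_0_right)
  have u: "\<not> is_unit p" using p not_prime_unit by blast
  have "f + g \<le> multiplicity p (x * y)"
    using dvd False x0 u by (intro multiplicity_geI) auto
  also have "\<dots> = multiplicity p x + multiplicity p y"
    using p False x0 by (intro prime_elem_multiplicity_mult_distrib) auto
  finally have "f + g \<le> multiplicity p x + multiplicity p y" .
  moreover have "multiplicity p x < f"
    using x x0 u by (intro multiplicity_lessI)
  ultimately show ?thesis by (intro multiplicity_dvd') simp
qed simp

text \<open>For \<open>j > 0\<close> the product equals \<open>N * binom(N+j-1, j-1)\<close>. It
  forces the binomial coefficient to be divisible by a high power of \<open>p\<close> unless
  \<open>j\<close> is.\<close>

lemma dvd_mult_binomial: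
  fixes N j :: nat
  shows "N dvd j * ((N + j - 1) choose j)"
proof (cases j)
  case (Suc i)
  have "Suc i * (N + i choose Suc i) = N * (N + i choose i)"
    using binomial_absorption[of i "N + i"] binomial_absorb_comp[of "N + i" i] by simp
  then show ?thesis by (simp add: Suc)
qed simp

text \<open>The hockey stick identity, by Pascal's rule. For \<open>J = N = 0\<close> truncated
  subtraction would make the right side 1.\<close>

lemma sum_multichoose:
  assumes "J > 0"
  shows "(\<Sum>j<J. (N + j - 1) choose j) = (N + J - 1) choose N"
  using assms
proof (induction J)
  case (Suc J)
  show ?case
  proof (cases J)
    case (Suc i)
    have "(N + J - 1 choose N) + (N + J - 1 choose J) = (N + J choose N)"
      using Suc binomial_symmetric[of J "N + i + 1"] binomial_symmetric[of "N" "N + i"] by simp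
    then show ?thesis using Suc.IH Suc by simp
  qed simp
qed simp

text \<open>The condition \<open>2 * f \<le> e\<close> lets the factor \<open>p^e\<close> of
  \<open>j * binom(N+j-1, j)\<close> be shared out: \<open>p^f\<close> divides \<open>j\<close> or
  the binomial coefficient. Multiplication by \<open>(-1)^d d!\<close> keeps
  \<open>T\<^sub>p(d-1,d)\<close> integral.\<close>

lemma Stirling_partial_binomial_cong:
  assumes p: "prime p" and c: "c > 0" and d: "d > 0" and f: "2 * f \<le> e"
  shows "dvd_cong (int (p ^ f))
      ((-1) ^ d * fact d * int (Stirling (p ^ Suc e * (b + (p - 1) * c) + (d - 1)) (p ^ Suc e * b + d)))
      (partial_Stirling_num p (d - 1) d * int ((p ^ e * (b + p * c) - 1) choose (p ^ e * b)))"
proof -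
  define J where "J = p ^ Suc e * c"
  define N where "N = p ^ e * b"
  let ?\<tau> = "partial_Stirling_num p (d - 1) d"
  let ?s = "(-1) ^ d * fact d :: int"
  have J: "J > 0" using c prime_gt_0_nat[OF p] by (simp add: J_def)
  have "dvd_cong (int (p ^ f))
      (int (Stirling (p ^ Suc e * (b + (p - 1) * c) + (d - 1)) (p ^ Suc e * b + d)))
      (\<Sum>j<J. int ((N + j - 1) choose j) * int (Stirling ((p - 1) * (J - j) + (d - 1)) d))"
    unfolding J_def N_def
    by (rule dvd_cong_dvd[OF Stirling_prime_power_cong[OF p c d]])
       (use f in \<open>simp add: le_imp_power_dvd flip: of_nat_power\<close>)
  then have "dvd_cong (int (p ^ f))
      (?s * int (Stirling (p ^ Suc e * (b + (p - 1) * c) + (d - 1)) (p ^ Suc e * b + d)))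
      (?s * (\<Sum>j<J. int ((N + j - 1) choose j) * int (Stirling ((p - 1) * (J - j) + (d - 1)) d)))"
    by (intro dvd_cong_mult dvd_cong_refl)
  also have "?s * (\<Sum>j<J. int ((N + j - 1) choose j) * int (Stirling ((p - 1) * (J - j) + (d - 1)) d))
      = (\<Sum>j<J. int ((N + j - 1) choose j) * (?s * int (Stirling ((p - 1) * (J - j) + (d - 1)) d)))"
    by (simp add: sum_distrib_left mult_ac)
  also have "dvd_cong (int (p ^ f)) \<dots> (\<Sum>j<J. int ((N + j - 1) choose j) * ?\<tau>)"
  proof (rule dvd_cong_sum)
    fix j assume "j \<in> {..<J}"
    then have j: "j < J" by simp
    show "dvd_cong (int (p ^ f))
       (int ((N + j - 1) choose j) * (?s * int (Stirling ((p - 1) * (J - j) + (d - 1)) d)))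
       (int ((N + j - 1) choose j) * ?\<tau>)"
    \<comment> \<open>In the first case \<open>p^f\<close> divides \<open>J - j > 0\<close> as well,
      so the Stirling factor may be replaced; in the second case both terms vanish modulo
      \<open>p^f\<close>.\<close>
    proof (cases "p ^ f dvd j")
      case True
      moreover have "p ^ f dvd J"
        unfolding J_def using f by (intro dvd_mult2 le_imp_power_dvd) simp
      ultimately have "p ^ f dvd J - j" by (rule dvd_diff_nat[rotated])
      then show ?thesis
        using j by (intro dvd_cong_mult dvd_cong_refl Stirling_partial_cong p) simp_all
    next
      case False
      have "p ^ (f + f) dvd p ^ e" using f by (intro le_imp_power_dvd) simp
      also have "p ^ e dvd N" by (simp add: N_def)
      also have "N dvd j * ((N + j - 1) choose j)" by (rule dvd_mult_binomial)
      finally have "p ^ f dvd ((N + j - 1) choose j)"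
        using False by (rule prime_power_dvd_factor[OF p])
      then have "int (p ^ f) dvd int ((N + j - 1) choose j)" by (simp only: of_nat_dvd_iff)
      then show ?thesis unfolding dvd_cong_def right_diff_distrib[symmetric] by (rule dvd_mult2)
    qed
  qed
  also have "(\<Sum>j<J. int ((N + j - 1) choose j) * ?\<tau>) = ?\<tau> * int (\<Sum>j<J. (N + j - 1) choose j)"
    by (simp add: sum_distrib_left mult.commute)
  also have "(\<Sum>j<J. (N + j - 1) choose j) = (p ^ e * (b + p * c) - 1) choose (p ^ e * b)"
    unfolding sum_multichoose[OF J] by (simp add: N_def J_def algebra_simps)
  finally show ?thesis .
qed

section \<open>Binomial coefficients with arguments multiplied by prime powers\<close>

lemma one_plus_power_prime_cong:
  fixes x :: "'a::comm_ring_1"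
  assumes p: "prime p"
  shows "dvd_cong (of_nat p) ((1 + x) ^ p) (1 + x ^ p)"
proof -
  have p0: "p > 0" using p by (rule prime_gt_0_nat)
  have "(1 + x) ^ p = (\<Sum>k\<le>p. of_nat (p choose k) * x ^ k)"
    using binomial_ring[of x 1 p] by (simp add: add.commute)
  also have "dvd_cong (of_nat p) \<dots> (\<Sum>k\<le>p. if k = 0 \<or> k = p then x ^ k else 0)"
  proof (rule dvd_cong_sum)
    fix k assume k: "k \<in> {..p}"
    show "dvd_cong (of_nat p) (of_nat (p choose k) * x ^ k) (if k = 0 \<or> k = p then x ^ k else 0)"
    proof (cases "k = 0 \<or> k = p")
      case False
      then have "p dvd p choose k" using k p by (intro dvd_choose_prime) auto
      then have "(of_nat p :: 'a) dvd of_nat (p choose k)" by (auto elim!: dvdE)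
      then show ?thesis using False by (simp add: dvd_cong_def)
    qed auto
  qed
  also have "(\<Sum>k\<le>p. if k = 0 \<or> k = p then x ^ k else 0) = (\<Sum>k\<in>{0, p}. x ^ k)"
    by (intro sum.mono_neutral_cong_right) auto
  also have "\<dots> = 1 + x ^ p" using p0 by simp
  finally show ?thesis .
qed

lemma one_plus_power_prime_power_cong:
  fixes x :: "'a::comm_ring_1"
  assumes p: "prime p"
  shows "dvd_cong (of_nat p ^ Suc e) ((1 + x) ^ (p ^ Suc e)) ((1 + x ^ p) ^ (p ^ e))"
proof (induction e)
  case 0
  show ?case using one_plus_power_prime_cong[OF p] by simp
next
  case (Suc e)
  from dvd_cong_power_prime_lift[OF this] show ?case
    by (simp add: mult.commute flip: power_mult)
qed

lemma one_plus_X_power_nth: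
  assumes "m > 0"
  shows "((1 + fps_X ^ m) ^ n :: int fps) $ (m * k) = int (n choose k)"
proof -
  have "((1 + fps_X ^ m) ^ n :: int fps) = (\<Sum>i\<le>n. fps_const (int (n choose i)) * fps_X ^ (m * i))"
    using binomial_ring[of "fps_X ^ m :: int fps" 1 n]
    by (simp add: add.commute fps_of_nat flip: power_mult)
  then have "((1 + fps_X ^ m) ^ n :: int fps) $ (m * k) = (\<Sum>i\<le>n. int (n choose i) * (if k = i then 1 else 0))"
    using assms by (simp add: fps_sum_nth)
  also have "\<dots> = int (n choose k)" by (simp add: if_distrib cong: if_cong)
  finally show ?thesis .
qed

text \<open>Compare the coefficients of \<open>X^(p^(e+1) \<beta>)\<close> in
  \<open>(1 + X)^(p^(e+1) \<alpha>)\<close> and \<open>(1 + X^p)^(p^e \<alpha>)\<close>, which are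
  congruent modulo \<open>p^(e+1)\<close>.\<close>

lemma binomial_prime_power_cong:
  assumes p: "prime p"
  shows "dvd_cong (int (p ^ Suc e)) (int (p ^ Suc e * \<alpha> choose (p ^ Suc e * \<beta>)))
           (int (p ^ e * \<alpha> choose (p ^ e * \<beta>)))"
proof -
  have p0: "p > 0" using p by (rule prime_gt_0_nat)
  \<comment> \<open>The exponent 1, and the factor 1 in the index below, let
    \<open>one_plus_X_power_nth\<close> read off this side too.\<close>
  have "dvd_cong (of_nat (p ^ Suc e)) ((1 + fps_X ^ 1) ^ (p ^ Suc e * \<alpha>)) (((1 + fps_X ^ p) ^ (p ^ e * \<alpha>)) :: int fps)"
    using dvd_cong_power[OF one_plus_power_prime_power_cong[OF p, of e fps_X], of \<alpha>]
    by (simp only: power_one_right of_nat_power power_mult)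
  from dvd_cong_fps_nth[OF this, of "1 * (p ^ Suc e * \<beta>)"]
  have "dvd_cong (of_nat (p ^ Suc e)) (int (p ^ Suc e * \<alpha> choose (p ^ Suc e * \<beta>)))
     (((1 + fps_X ^ p) ^ (p ^ e * \<alpha>) :: int fps) $ (1 * (p ^ Suc e * \<beta>)))"
    by (subst (asm) one_plus_X_power_nth) simp_all
  also have "1 * (p ^ Suc e * \<beta>) = p * (p ^ e * \<beta>)" by simp
  finally show ?thesis unfolding one_plus_X_power_nth[OF p0] .
qed

text \<open>From \<open>\<alpha> * binom(p^e \<alpha> - 1, p^e \<beta>) = (\<alpha> - \<beta>) *
  binom(p^e \<alpha>, p^e \<beta>)\<close>. The factor \<open>\<alpha>\<close> stays because
  \<open>p\<close> may divide it; being fixed, it does not disturb convergence.\<close>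

lemma binomial_minus_1_prime_power_cong:
  assumes p: "prime p" and "\<beta> \<le> \<alpha>"
  shows "int (p ^ Suc e) dvd int \<alpha> * (int ((p ^ Suc e * \<alpha> - 1) choose (p ^ Suc e * \<beta>))
            - int ((p ^ e * \<alpha> - 1) choose (p ^ e * \<beta>)))"
proof -
  have eq: "int \<alpha> * int ((p ^ e * \<alpha> - 1) choose (p ^ e * \<beta>)) = int (\<alpha> - \<beta>) * int (p ^ e * \<alpha> choose (p ^ e * \<beta>))" for e
  proof -
    have "p ^ e * (\<alpha> * ((p ^ e * \<alpha> - 1) choose (p ^ e * \<beta>))) = p ^ e * ((\<alpha> - \<beta>) * (p ^ e * \<alpha> choose (p ^ e * \<beta>)))"
      using binomial_absorb_comp[of "p ^ e * \<alpha>" "p ^ e * \<beta>"]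
      by (simp add: algebra_simps diff_mult_distrib2)
    then have "\<alpha> * ((p ^ e * \<alpha> - 1) choose (p ^ e * \<beta>)) = (\<alpha> - \<beta>) * (p ^ e * \<alpha> choose (p ^ e * \<beta>))"
      using prime_gt_0_nat[OF p] by simp
    then show ?thesis by (simp only: flip: of_nat_mult)
  qed
  show ?thesis
    using binomial_prime_power_cong[OF p, of e \<alpha> \<beta>]
    unfolding right_diff_distrib eq unfolding dvd_cong_def right_diff_distrib[symmetric]
    by (rule dvd_mult)
qed

section \<open>Null sequences, Cauchy sequences and limits\<close>

lemma padic_abs_of_int_le:
  assumes p: "prime p" and z: "int (p ^ k) dvd z"
  shows "padic_abs p (of_int z) \<le> (1 / real p) ^ k"
proof (cases "z = 0")
  case False
  have p1: "p > 1" using p by (rule prime_gt_1_nat)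
  have "padic_val p (of_int z) = int (multiplicity (int p) z)"
    using padic_val_divide[OF p False, of 1] by simp
  then have "padic_abs p (of_int z) = (1 / real p) ^ multiplicity (int p) z"
    using False by (simp add: padic_abs_def power_int_minus power_inverse divide_inverse)
  moreover have "k \<le> multiplicity (int p) z"
    using z False p1 by (intro multiplicity_geI) auto
  ultimately show ?thesis
    using p1 by (simp only:) (intro power_decreasing, auto)
qed simp

text \<open>Turns integer divisibility into convergence: the fixed factor \<open>C\<close> only
  rescales the absolute values. It will be \<open>\<alpha>\<close> or
  \<open>(-1)^d d!\<close>.\<close>

lemma padic_nullI:
  assumes p: "prime p" and C: "C \<noteq> 0" and g: "filterlim g at_top sequentially"
    and z: "\<And>n. C * x n = of_int (z n)" "\<And>n. int (p ^ g n) dvd z n"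
  shows "x \<in> padic_null p"
proof -
  have C0: "padic_abs p C > 0"
    using padic_abs_eq_0_iff[OF p, of C] padic_abs_nonneg[of p C] C by linarith
  have "(\<lambda>k. (1 / real p) ^ k) \<longlonglongrightarrow> 0"
    using prime_gt_1_nat[OF p] by (intro LIMSEQ_power_zero) simp
  from tendsto_divide_zero[OF filterlim_compose[OF this g]]
  have lim: "(\<lambda>n. (1 / real p) ^ g n / padic_abs p C) \<longlonglongrightarrow> 0" .
  have "padic_abs p (x n) \<le> (1 / real p) ^ g n / padic_abs p C" for n
    using padic_abs_of_int_le[OF p z(2)[of n]] C0
    by (simp add: z(1)[symmetric] padic_abs_mult[OF p] pos_le_divide_eq mult.commute)
  then show ?thesis
    unfolding padic_null_iff
    by (intro Lim_null_comparison[OF always_eventually lim]) simp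
qed

text \<open>By the ultrametric inequality it is enough to control consecutive terms.\<close>

lemma padic_CauchyI:
  assumes p: "prime p" and null: "(\<lambda>n. x (Suc n) - x n) \<in> padic_null p"
  shows "x \<in> padic_Cauchy p"
  unfolding padic_Cauchy_def
proof (intro CollectI allI impI)
  fix \<epsilon> :: real assume e: "\<epsilon> > 0"
  then obtain N where N: "\<And>n. n \<ge> N \<Longrightarrow> padic_abs p (x (Suc n) - x n) < \<epsilon>"
    using order_tendstoD(2)[OF null[unfolded padic_null_iff]] by (auto simp: eventually_sequentially)
  have base: "padic_abs p (x n - x N) < \<epsilon>" if "n \<ge> N" for n
    using that
  proof (induction n rule: dec_induct)
    case (step n)
    then show ?case
      using padic_abs_add[OF p, of "x (Suc n) - x n" "x n - x N"] N[of n] by simp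
  qed (use e in simp)
  have "padic_abs p (x m - x n) < \<epsilon>" if "m \<ge> N" "n \<ge> N" for m n
    using padic_abs_add[OF p, of "x m - x N" "x N - x n"] base[OF that(1)] base[OF that(2)]
    by (simp add: padic_abs_minus_commute[of p "x N"])
  then show "\<exists>N. \<forall>m\<ge>N. \<forall>n\<ge>N. padic_abs p (x m - x n) < \<epsilon>" by blast
qed

text \<open>A Cauchy sequence of integers converges to its own class, which has norm at most 1 as a
  limit of integers.\<close>

lemma limitin_padic_class:
  assumes p: "prime p" and f: "(\<lambda>n. of_int (f n)) \<in> padic_Cauchy p"
  shows "limitin (Zp_topology p) (\<lambda>e. padic_of_rat p (of_int (f e)))
           (padic_class p (\<lambda>n. of_int (f n))) sequentially"
proof -
  let ?L = "padic_class p (\<lambda>n. of_int (f n))"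
  have "padic_norm p ?L \<le> 1"
    using padic_norm_class[OF p f] padic_abs_of_int_le_1[OF p] by (intro LIMSEQ_le_const2) auto
  then have "?L \<in> Zp p" using f by (auto simp: Zp_def carrier_Qp)
  moreover have "\<exists>N. \<forall>e\<ge>N. padic_of_rat p (of_int (f e)) \<in> Zp p \<and> padic_dist p (padic_of_rat p (of_int (f e))) ?L < \<epsilon>"
    if "\<epsilon> > 0" for \<epsilon>
  proof -
    \<comment> \<open>Halved because the strict bound becomes a weak one in the limit.\<close>
    have "\<epsilon> / 2 > 0" using that by simp
    then obtain N where N: "\<And>m n. m \<ge> N \<Longrightarrow> n \<ge> N \<Longrightarrow> padic_abs p (of_int (f m) - of_int (f n)) < \<epsilon> / 2"
      using f unfolding padic_Cauchy_def by blast
    have "padic_dist p (padic_of_rat p (of_int (f e))) ?L < \<epsilon>" if "e \<ge> N" for e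
    proof -
      have "padic_dist p (padic_of_rat p (of_int (f e))) ?L \<le> \<epsilon> / 2"
        unfolding padic_of_rat_def
        by (rule LIMSEQ_le_const2[OF padic_dist_class[OF p padic_Cauchy_const f]])
           (use N[OF that] less_imp_le in blast)
      then show ?thesis using \<open>\<epsilon> > 0\<close> by simp
    qed
    then show ?thesis using padic_of_int_Zp[OF p] by blast
  qed
  ultimately show ?thesis
    unfolding Zp_topology_def Metric_space.limit_metric_sequentially[OF Metric_space_Zp[OF p]]
    by blast
qed

lemma binomial_seq_of_nat:
  assumes p: "prime p" and m: "m > 0"
  shows "binomial_seq p (int m) (int n) e = int ((p ^ e * m - 1) choose (p ^ e * n))"
proof -
  have "1 \<le> p ^ e * m" using m prime_gt_0_nat[OF p] by (simp add: Suc_le_eq)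
  then have eq: "int p ^ e * int m - 1 = int (p ^ e * m - 1)"
    by (simp only: of_nat_diff of_nat_mult of_nat_power of_nat_1)
  have eq': "int p ^ e * int n = int (p ^ e * n)" by simp
  show ?thesis unfolding binomial_seq_def binomial_int_def eq eq'
    by (simp only: of_nat_le_iff of_nat_0_le_iff nat_int) (auto simp: binomial_eq_0)
qed

lemma binomial_seq_diff_null:
  assumes p: "prime p" and "0 \<le> \<beta>" "\<beta> \<le> \<alpha>"
  shows "(\<lambda>e. of_int (binomial_seq p \<alpha> \<beta> (Suc e)) - of_int (binomial_seq p \<alpha> \<beta> e)) \<in> padic_null p"
proof (cases "\<alpha> = 0")
  case True
  \<comment> \<open>Here \<open>\<beta> = 0\<close> too, and \<open>binomial_int (- 1) 0\<close> is
    0 by convention.\<close>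
  then have "binomial_seq p \<alpha> \<beta> = (\<lambda>e. 0)"
    using assms by (auto simp: binomial_seq_def binomial_int_def)
  then show ?thesis by (simp add: padic_null_iff)
next
  case False
  obtain m where m: "\<alpha> = int m" "m > 0" using False assms by (metis gr0I nonneg_int_cases of_nat_0 order_trans)
  obtain n where n: "\<beta> = int n" using assms nonneg_int_cases by blast
  show ?thesis
  proof (rule padic_nullI[OF p])
    show "(of_nat m :: rat) \<noteq> 0" using m by simp
    show "filterlim Suc at_top sequentially" by (rule filterlim_Suc)
    fix e
    let ?z = "int m * (binomial_seq p \<alpha> \<beta> (Suc e) - binomial_seq p \<alpha> \<beta> e)"
    show "of_nat m * (of_int (binomial_seq p \<alpha> \<beta> (Suc e)) - of_int (binomial_seq p \<alpha> \<beta> e)) = (of_int ?z :: rat)"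
      by simp
    show "int (p ^ Suc e) dvd ?z"
      unfolding m(1) n binomial_seq_of_nat[OF p m(2)]
      using assms by (intro binomial_minus_1_prime_power_cong p) (simp add: m n)
  qed
qed

section \<open>Passage to the p-adic limit\<close>

lemma partial_Stirling_eq:
  "partial_Stirling p (int n) k = (-1) ^ k / fact k * of_int (partial_Stirling_num p n k)"
  by (simp add: partial_Stirling_def partial_Stirling_num_def cong_0_iff)

text \<open>The congruence with \<open>f = e div 2\<close>, which tends to infinity. It pairs
  \<open>p^(e+1)\<close> in the Stirling number with \<open>p^e\<close> in the binomial coefficient,
  hence the shifted index.\<close>

lemma Stirling_binomial_null:
  assumes p: "prime p" and c: "c > 0" and d: "d > 0"
  shows "(\<lambda>e. of_int (Stirling_seq p (int (b + (p - 1) * c)) (int d - 1) (int b) (int d) (Suc e))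
           - partial_Stirling p (int d - 1) d * of_int (binomial_seq p (int (b + p * c)) (int b) e))
         \<in> padic_null p"
proof (rule padic_nullI[OF p])
  show "((-1) ^ d * fact d :: rat) \<noteq> 0" by simp
  show "filterlim (\<lambda>e::nat. e div 2) at_top sequentially"
    unfolding filterlim_at_top
  proof
    fix Z :: nat
    show "\<forall>\<^sub>F e in sequentially. Z \<le> e div 2"
      by (rule eventually_sequentiallyI[of "2 * Z"]) simp
  qed
  fix e
  define S where "S = Stirling (p ^ Suc e * (b + (p - 1) * c) + (d - 1)) (p ^ Suc e * b + d)"
  define B where "B = (p ^ e * (b + p * c) - 1) choose (p ^ e * b)"
  have d1: "int d - 1 = int (d - 1)" using d by simp
  have "int p ^ Suc e * int (b + (p - 1) * c) + int (d - 1) = int (p ^ Suc e * (b + (p - 1) * c) + (d - 1))"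
    "int p ^ Suc e * int b + int d = int (p ^ Suc e * b + d)"
    by (simp_all only: of_nat_add of_nat_mult of_nat_power)
  then have S: "Stirling_seq p (int (b + (p - 1) * c)) (int d - 1) (int b) (int d) (Suc e) = int S"
    unfolding Stirling_seq_def Stirling_int_def d1 S_def by (simp only: nat_int of_nat_0_le_iff simp_thms if_True)
  have "b + p * c > 0" using c prime_gt_0_nat[OF p] by simp
  then have B: "binomial_seq p (int (b + p * c)) (int b) e = int B"
    unfolding B_def by (rule binomial_seq_of_nat[OF p])
  let ?z = "(-1) ^ d * fact d * int S - partial_Stirling_num p (d - 1) d * int B"
  have "((-1) ^ d * fact d) * ((-1) ^ d / fact d) = (1 :: rat)"
    by (simp flip: power_mult_distrib)
  then show "(-1) ^ d * fact d * (of_int (Stirling_seq p (int (b + (p - 1) * c)) (int d - 1) (int b) (int d) (Suc e))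
           - partial_Stirling p (int d - 1) d * of_int (binomial_seq p (int (b + p * c)) (int b) e)) = (of_int ?z :: rat)"
    unfolding S B unfolding d1 partial_Stirling_eq by (simp add: right_diff_distrib)
  show "int (p ^ (e div 2)) dvd ?z"
    using Stirling_partial_binomial_cong[OF p c d, of "e div 2" e b]
    unfolding dvd_cong_def S_def B_def by simp
qed

lemma padic_class_mult_rat:
  assumes p: "prime p" and x: "x \<in> padic_Cauchy p"
  shows "padic_of_rat p r \<otimes>\<^bsub>Qp p\<^esub> padic_class p x = padic_class p (\<lambda>n. r * x n)"
proof -
  interpret ring_hom_cring "padic_Cauchy_ring p" "Qp p" "padic_class p"
    using p by (rule padic_class_ring_hom)
  show ?thesis
    using hom_mult[of "\<lambda>_. r" x] x by (simp add: padic_Cauchy_ring_def padic_of_rat_def)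
qed

lemma padic_null_Suc_iff: "(\<lambda>n. x (Suc n)) \<in> padic_null p \<longleftrightarrow> x \<in> padic_null p"
  unfolding padic_null_iff by (rule filterlim_sequentially_Suc)

theorem theorem1p5:
  fixes p :: nat and a b d :: int
  assumes "prime p"
    and "0 \<le> b" and "b \<le> a"
    and "[a = b] (mod (int p - 1))"
    and "d \<ge> 1"
  shows "padic_convergent p (Stirling_seq p a (d - 1) b d)
    \<and> padic_convergent p (binomial_seq p ((int p * a - b) div (int p - 1)) b)
    \<and> padic_Stirling p a (d - 1) b d
        = padic_of_rat p (partial_Stirling p (d - 1) (nat d))
            \<otimes>\<^bsub>Qp p\<^esub> padic_binomial p ((int p * a - b) div (int p - 1)) b"
proof -
  note p = \<open>prime p\<close>
  let ?S = "Stirling_seq p a (d - 1) b d" and ?T = "partial_Stirling p (d - 1) (nat d)"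
  let ?\<alpha> = "(int p * a - b) div (int p - 1)"
  let ?B = "binomial_seq p ?\<alpha> b"
  have p1: "int p > 1" using prime_gt_1_nat[OF p] by simp
  \<comment> \<open>With this \<open>c\<close> the quotient \<open>?\<alpha>\<close> is exactly
    \<open>b + pc\<close>.\<close>
  obtain c where c: "a - b = (int p - 1) * c"
    using assms(4) by (auto simp: cong_iff_dvd_diff)
  have c0: "c \<ge> 0" using c p1 assms(3) by (metis diff_ge_0_iff_ge diff_gt_0_iff_gt zero_le_mult_iff not_le)
  have a: "a = b + (int p - 1) * c" using c by simp
  have "int p * a - b = (b + int p * c) * (int p - 1)" unfolding a by (simp add: algebra_simps)
  then have \<alpha>: "?\<alpha> = b + int p * c" using p1 by simp
  have B_diff: "(\<lambda>e. of_int (?B (Suc e)) - of_int (?B e)) \<in> padic_null p"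
    using c0 p1 assms(2) unfolding \<alpha> by (intro binomial_seq_diff_null p) simp_all
  then have B: "(\<lambda>e. of_int (?B e)) \<in> padic_Cauchy p" by (rule padic_CauchyI[OF p])
  have TB: "(\<lambda>e. ?T * of_int (?B e)) \<in> padic_Cauchy p"
    using padic_Cauchy_mult[OF p padic_Cauchy_const B] by simp
  have null: "(\<lambda>e. of_int (?S e) - ?T * of_int (?B e)) \<in> padic_null p"
  proof (cases "c = 0")
    case True
    \<comment> \<open>For \<open>a = b\<close> both sequences are 0: the lower index exceeds the
      upper one by 1 in the Stirling number and, as \<open>?\<alpha> = b\<close>, in the binomial
      coefficient.\<close>
    have "nat (int p ^ e * b + (d - 1)) < nat (int p ^ e * b + d)" for e
      using assms(2,5) p1 by (simp add: zless_nat_conj add_nonneg_pos)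
    then have "?S e = 0" "?B e = 0" for e
      unfolding \<alpha> using True a
      by (auto simp: Stirling_seq_def Stirling_int_def binomial_seq_def binomial_int_def)
    then show ?thesis by (simp add: padic_null_iff)
  next
    case False
    define b' c' d' where "b' = nat b" and "c' = nat c" and "d' = nat d"
    have nats: "b = int b'" "c = int c'" "d = int d'" "c' > 0" "d' > 0"
      using False c0 assms by (simp_all add: b'_def c'_def d'_def)
    have a': "a = int (b' + (p - 1) * c')"
      unfolding a nats using p1 by (simp add: of_nat_diff)
    have \<alpha>': "?\<alpha> = int (b' + p * c')" unfolding \<alpha> unfolding nats by simp
    have "(\<lambda>e. of_int (?S (Suc e)) - ?T * of_int (?B e)) \<in> padic_null p"
      using Stirling_binomial_null[OF p nats(4,5), of b'] unfolding \<alpha>' unfolding a' nats(1,3) by simp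
    \<comment> \<open>Consecutive terms of \<open>?B\<close> differ by a null sequence, which aligns
      the indices of \<open>?S\<close> and \<open>?B\<close>.\<close>
    moreover have "(\<lambda>e. (of_int (?B (Suc e)) - of_int (?B e)) * - ?T) \<in> padic_null p"
      by (rule padic_null_mult[OF p B_diff padic_Cauchy_const])
    ultimately have "(\<lambda>e. (of_int (?S (Suc e)) - ?T * of_int (?B e))
        + (of_int (?B (Suc e)) - of_int (?B e)) * - ?T) \<in> padic_null p"
      by (rule padic_null_add[OF p])
    then have "(\<lambda>e. of_int (?S (Suc e)) - ?T * of_int (?B (Suc e))) \<in> padic_null p"
      by (simp add: algebra_simps)
    then show ?thesis by (subst (asm) padic_null_Suc_iff)
  qed
  \<comment> \<open>The Stirling limit exists because the sequence differs from the Cauchy sequence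
    \<open>?T * ?B\<close> by a null sequence.\<close>
  have S: "(\<lambda>e. of_int (?S e)) \<in> padic_Cauchy p"
    using padic_Cauchy_add[OF p subsetD[OF padic_null_subset[OF p] null] TB] by simp
  note limS = limitin_padic_class[OF p S] and limB = limitin_padic_class[OF p B]
  have "padic_Stirling p a (d - 1) b d = padic_class p (\<lambda>e. of_int (?S e))"
    unfolding padic_Stirling_def by (rule padic_lim_eqI[OF p limS])
  also have "\<dots> = padic_class p (\<lambda>e. ?T * of_int (?B e))"
    using null by (simp add: padic_class_eq_iff[OF p S TB])
  also have "\<dots> = padic_of_rat p ?T \<otimes>\<^bsub>Qp p\<^esub> padic_class p (\<lambda>e. of_int (?B e))"
    by (rule padic_class_mult_rat[OF p B, symmetric])
  also have "padic_class p (\<lambda>e. of_int (?B e)) = padic_binomial p ?\<alpha> b"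
    unfolding padic_binomial_def by (rule padic_lim_eqI[OF p limB, symmetric])
  finally show ?thesis
    using limS limB unfolding padic_convergent_def by blast
qed

end
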